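(* Suppose $f$ satisfies the basic assumptions and $\phi$ satisfies the divergence assumptions stated in the context, and let $x_n(\delta)$, for $\delta$ in a neighborhood of $0$, be the solution of the in-sample DRO problem ($\delta>0$), SAA problem ($\delta=0$) or DOO problem ($\delta<0$). Let $$\beta_n=\mathrm{Cov}_{\mathbb P_n}\big[\nabla_xf(x_n(0),Y),\,f(x_n(0),Y)\big].$$ Then the worst-case sensitivity satisfies $$\mathcal S_{\mathbb P_n}(f(x_n(\delta),Y))=\mathcal S_{\mathbb P_n}(f(x_n(0),Y))+\frac{2\delta}{[\phi''(1)]^2}\,\beta_n'\Big(\mathbb E_{\mathbb P_n}\big[\nabla_x^2f(x_n(0),Y)\big]\Big)^{-1}\beta_n+O(\delta^2),$$ where $$\beta_n'\Big(\mathbb E_{\mathbb P_n}\big[\nabla_x^2f(x_n(0),Y)\big]\Big)^{-1}\beta_n<0.$$ Consequently, in a neighborhood of $\delta=0$, solutions of the optimistic DOO problem ($\delta<0$) have a larger worst-case sensitivity than the SAA solution $x_n(0)$, while worst-case DRO solutions ($\delta>0$) have a smaller worst-case sensitivity.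
   Context: $f:\mathbb R^d\times\mathbb R^l\to\mathbb R$; $Y$ is an $\mathbb R^l$-valued random vector with distribution $\mathbb P$; $Y_1,\dots,Y_n$ are i.i.d. samples and $\mathbb P_n=[p_1^n,\dots,p_n^n]$ ($p_i^n>0$) is the empirical distribution, so $\mathbb E_{\mathbb P_n}[h(Y)]=\sum_ip_i^nh(Y_i)$. A prime denotes transpose; $\mathbb V$, $\mathrm{Cov}$ denote variance and covariance. **Basic assumptions on $f$.** (i) $f(x,Y)$ is strictly concave and twice continuously differentiable in $x\in\mathbb R^d$ for $\mathbb P$-almost every $Y$; (ii) for each fixed $x$, the maps $y\mapsto f(x,y),\nabla_xf(x,y),\nabla_x^2f(x,y)$ are measurable and all moments of $f(x,Y),\nabla_xf(x,Y),\nabla_x^2f(x,Y)$ exist; (iii) a maximizer $x^\star(0)$ of $\mathbb E_{\mathbb P}[f(x,Y)]$ exists. **Divergence assumptions on $\phi$.** $\phi:\mathbb R\to\mathbb R\cup\{+\infty\}$ is convex and lower semicontinuous, $\phi(z)\ge\phi(1)=0$ for $z\ge0$, $\phi(z)=+\infty$ for $z<0$, and $\phi$ is twice continuously differentiable around $z=1$ with $\phi''(1)>0$. For a probability vector $\mathbb Q=[q_1,\dots,q_n]$, $\mathcal H_\phi(\mathbb Q|\mathbb P_n)=\sum_ip_i^n\phi(q_i/p_i^n)$. **Solutions.** $x_n(0)=\arg\max_x\mathbb E_{\mathbb P_n}[f(x,Y)]$ (SAA). For $\delta>0$, $x_n(\delta)$ solves the DRO problem $\max_x\min_{\mathbb Q}\{\sum_iq_if(x,Y_i)+\frac1\delta\mathcal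 H_\phi(\mathbb Q|\mathbb P_n)\}$; for $\delta<0$ it solves the DOO problem $\max_x\max_{\mathbb Q}\{\sum_iq_if(x,Y_i)+\frac1\delta\mathcal H_\phi(\mathbb Q|\mathbb P_n)\}$. For $\delta$ near $0$ these are the solutions of the first-order conditions of the dual problem (with an auxiliary scalar variable $c$): $\mathbb E_{\mathbb P_n}\big[[\phi^*]'(-\delta[f(x,Y)+c])\nabla_xf(x,Y)\big]=0$ and $\mathbb E_{\mathbb P_n}\big[-\frac{\phi''(1)}\delta\{[\phi^*]'(-\delta[f(x,Y)+c])-1\}\big]=0$, where $\phi^*(\zeta)=\max_z\{\zeta z-\phi(z)\}$. **Worst-case sensitivity.** For a fixed decision $x$ let $\mathbb Q(0)=\mathbb P_n$ and, for $\varepsilon>0$, $\mathbb Q(\varepsilon)=\arg\min_{\mathbb Q}\{\sum_iq_if(x,Y_i)+\frac1\varepsilon\mathcal H_\phi(\mathbb Q|\mathbb P_n)\}$. Then $$\mathcal S_{\mathbb P_n}(f(x,Y)):=-\lim_{\varepsilon\downarrow0}\frac{\mathbb E_{\mathbb Q(\varepsilon)}[f(x,Y)]-\mathbb E_{\mathbb P_n}[f(x,Y)]}{\varepsilon},$$ which equals $\frac{1}{\phi''(1)}\mathbb V_{\mathbb P_n}[f(x,Y)]$. The quantity $\mathcal S_{\mathbb P_n}(f(x_n(\delta),Y))$ is obtained by substituting $x=x_n(\delta)$.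
   Formalization: The O(δ²) remainder is proved when the Hessians of f(·,Y_i) are Lipschitz near x_n(0) and φ'' is Lipschitz near 1 (otherwise o(δ)); the strict inequality and the strict comparisons assume β_n ≠ 0; the mean Hessian is assumed invertible; the result holds for almost every sample. *)

theory Defs
  imports "HOL-Probability.Probability" "HOL-Library.Landau_Symbols"
begin

section \<open>Derivatives and the basic assumptions on the reward\<close>

definition grad :: "(real^'d \<Rightarrow> real) \<Rightarrow> real^'d \<Rightarrow> real^'d" where
  "grad g x = (\<chi> i. frechet_derivative g (at x) (axis i 1))"

definition hessian :: "(real^'d \<Rightarrow> real) \<Rightarrow> real^'d \<Rightarrow> real^'d^'d" where
  "hessian g x = jacobian (grad g) (at x)"

definition twice_cont_diff :: "(real^'d \<Rightarrow> real) \<Rightarrow> bool" where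
  "twice_cont_diff g \<longleftrightarrow>
     g differentiable_on UNIV \<and> grad g differentiable_on UNIV \<and> continuous_on UNIV (hessian g)"

definition strictly_concave :: "('a::real_vector \<Rightarrow> real) \<Rightarrow> bool" where
  "strictly_concave g \<longleftrightarrow>
     (\<forall>x y u v. x \<noteq> y \<and> 0 < u \<and> 0 < v \<and> u + v = 1 \<longrightarrow>
        u * g x + v * g y < g (u *\<^sub>R x + v *\<^sub>R y))"

text \<open>For a random vector or matrix, existence of all (mixed) moments amounts to integrability of
  every power of its norm.\<close>
definition all_moments_exist :: "'b measure \<Rightarrow> ('b \<Rightarrow> 'a::euclidean_space) \<Rightarrow> bool" where
  "all_moments_exist P h \<longleftrightarrow> (\<forall>k::nat. integrable P (\<lambda>y. norm (h y) ^ k))"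

definition basic_assumptions :: "(real^'l) measure \<Rightarrow> (real^'d \<Rightarrow> real^'l \<Rightarrow> real) \<Rightarrow> bool" where
  "basic_assumptions P f \<longleftrightarrow>
     (AE y in P. strictly_concave (\<lambda>x. f x y) \<and> twice_cont_diff (\<lambda>x. f x y)) \<and>
     (\<forall>x. (\<lambda>y. f x y) \<in> borel_measurable P \<and>
          (\<lambda>y. grad (\<lambda>z. f z y) x) \<in> borel_measurable P \<and>
          (\<lambda>y. hessian (\<lambda>z. f z y) x) \<in> borel_measurable P \<and>
          all_moments_exist P (\<lambda>y. f x y) \<and>
          all_moments_exist P (\<lambda>y. grad (\<lambda>z. f z y) x) \<and>
          all_moments_exist P (\<lambda>y. hessian (\<lambda>z. f z y) x)) \<and>
     (\<exists>xs. \<forall>x. (\<integral>y. f x y \<partial>P) \<le> (\<integral>y. f xs y \<partial>P))"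

section \<open>Divergences\<close>

text \<open>The second derivative of the finite part of an extended-real-valued function.\<close>
definition deriv2 :: "(real \<Rightarrow> ereal) \<Rightarrow> real \<Rightarrow> real" where
  "deriv2 \<phi> = deriv (deriv (\<lambda>z. real_of_ereal (\<phi> z)))"

definition divergence_function :: "(real \<Rightarrow> ereal) \<Rightarrow> bool" where
  "divergence_function \<phi> \<longleftrightarrow>
     (\<forall>z. \<phi> z \<noteq> - \<infinity>) \<and>
     (\<forall>x y u v. 0 \<le> u \<and> 0 \<le> v \<and> u + v = 1 \<longrightarrow>
        \<phi> (u * x + v * y) \<le> ereal u * \<phi> x + ereal v * \<phi> y) \<and>
     (\<forall>z. \<phi> z \<le> Liminf (at z) \<phi>) \<and>
     \<phi> 1 = 0 \<and> (\<forall>z\<ge>0. 0 \<le> \<phi> z) \<and> (\<forall>z<0. \<phi> z = \<infinity>) \<and>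
     (\<exists>e>0. (\<forall>z\<in>ball 1 e. \<phi> z \<noteq> \<infinity>) \<and>
        (\<lambda>z. real_of_ereal (\<phi> z)) differentiable_on ball 1 e \<and>
        deriv (\<lambda>z. real_of_ereal (\<phi> z)) differentiable_on ball 1 e \<and>
        continuous_on (ball 1 e) (deriv2 \<phi>)) \<and>
     0 < deriv2 \<phi> 1"

definition prob_vectors :: "(real^'n) set" where
  "prob_vectors = {q. (\<forall>i. 0 \<le> q $ i) \<and> (\<Sum>i\<in>UNIV. q $ i) = 1}"

definition phi_divergence :: "(real \<Rightarrow> ereal) \<Rightarrow> real^'n \<Rightarrow> real^'n \<Rightarrow> ereal" where
  "phi_divergence \<phi> q p = (\<Sum>i\<in>UNIV. ereal (p $ i) * \<phi> (q $ i / p $ i))"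

section \<open>Empirical moments\<close>

definition emp_mean :: "real^'n \<Rightarrow> ('n \<Rightarrow> 'a::real_vector) \<Rightarrow> 'a" where
  "emp_mean p h = (\<Sum>i\<in>UNIV. p $ i *\<^sub>R h i)"

definition emp_cov :: "real^'n \<Rightarrow> ('n \<Rightarrow> 'a::real_vector) \<Rightarrow> ('n \<Rightarrow> real) \<Rightarrow> 'a" where
  "emp_cov p g h = emp_mean p (\<lambda>i. (h i - emp_mean p h) *\<^sub>R (g i - emp_mean p g))"

section \<open>SAA, DRO and DOO problems\<close>

text \<open>In the definitions below, \<open>v i\<close> is the reward in scenario \<open>i\<close>, i.e. the value of
  \<open>f x (Y i)\<close> for a fixed decision \<open>x\<close>.\<close>

definition penalized :: "(real \<Rightarrow> ereal) \<Rightarrow> real^'n \<Rightarrow> ('n \<Rightarrow> real) \<Rightarrow> real \<Rightarrow> real^'n \<Rightarrow> ereal" where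
  "penalized \<phi> p v \<delta> q = ereal (emp_mean q v) + ereal (1 / \<delta>) * phi_divergence \<phi> q p"

text \<open>The inner infimum and supremum are attained, because \<open>prob_vectors\<close> is compact and \<open>\<phi>\<close>
  is lower semicontinuous.\<close>
definition objective :: "(real \<Rightarrow> ereal) \<Rightarrow> real^'n \<Rightarrow> real \<Rightarrow> ('n \<Rightarrow> real) \<Rightarrow> ereal" where
  "objective \<phi> p \<delta> v =
     (if \<delta> > 0 then (INF q\<in>prob_vectors. penalized \<phi> p v \<delta> q)
      else if \<delta> < 0 then (SUP q\<in>prob_vectors. penalized \<phi> p v \<delta> q)
      else ereal (emp_mean p v))"

definition solves ::
    "(real \<Rightarrow> ereal) \<Rightarrow> real^'n \<Rightarrow> (real^'d \<Rightarrow> 'n \<Rightarrow> real) \<Rightarrow> real \<Rightarrow> real^'d \<Rightarrow> bool" where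
  "solves \<phi> p F \<delta> x \<longleftrightarrow> (\<forall>z. objective \<phi> p \<delta> (F z) \<le> objective \<phi> p \<delta> (F x))"

section \<open>Worst-case sensitivity\<close>

definition worst_case_dist :: "(real \<Rightarrow> ereal) \<Rightarrow> real^'n \<Rightarrow> ('n \<Rightarrow> real) \<Rightarrow> real \<Rightarrow> real^'n" where
  "worst_case_dist \<phi> p v \<epsilon> = arg_min_on (penalized \<phi> p v \<epsilon>) prob_vectors"

definition sensitivity :: "(real \<Rightarrow> ereal) \<Rightarrow> real^'n \<Rightarrow> ('n \<Rightarrow> real) \<Rightarrow> real" where
  "sensitivity \<phi> p v =
     - Lim (at_right 0) (\<lambda>\<epsilon>. (emp_mean (worst_case_dist \<phi> p v \<epsilon>) v - emp_mean p v) / \<epsilon>)"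

section \<open>Additional regularity\<close>

text \<open>With second derivatives that are merely continuous, the first-order expansion of the
  sensitivity has remainder \<open>o(\<delta>)\<close> but in general not \<open>O(\<delta>\<^sup>2)\<close>: for \<open>d = 1\<close>, equal weights on
  two scenarios and \<open>\<phi> z = (z - 1)\<^sup>2\<close> for \<open>z \<ge> 0\<close>, take strictly concave rewards whose mean
  has derivative \<open>- x + x * sqrt \<bar>x\<bar>\<close> near \<open>0\<close> and for which \<open>\<beta> \<noteq> 0\<close>.  The
  quadratic remainder holds once the second derivatives are Lipschitz near the point in question.\<close>
definition lipschitz_near :: "('a::metric_space \<Rightarrow> 'b::metric_space) \<Rightarrow> 'a \<Rightarrow> bool" where
  "lipschitz_near g a \<longleftrightarrow> (\<exists>e>0. \<exists>L. L-lipschitz_on (ball a e) g)"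

end

(* At an inner optimizer the likelihood ratios are q_i / p_i = 1 - (delta / phi''(1)) (f_i - E f) + o(delta):
   stationarity of the penalized objective, linearized at the ratio 1.  Applied to a fixed decision, this
   gives S = Var / phi''(1).  Applied to x_n(delta), an envelope argument yields
   E grad f - (delta / phi''(1)) Cov(grad f, f) = o(delta) there, hence
   x_n(delta) - x_n(0) = (delta / phi''(1)) A^{-1} beta + o(delta), where A is the mean Hessian; the
   gradient of Var is 2 Cov(grad f, f).  A Lipschitz second derivative turns each o(delta) into
   O(delta^2). *)

theory Submission
  imports Defs
begin

section \<open>Empirical means and variances\<close>

text \<open>The solution path \<open>x\<close> is known only through \<open>solves\<close> near 0:
  no continuity, uniqueness or dual variable is given, so an implicit function argument has nothing
  to start from. Everything comes from comparing objective values. Two consequences shape the proof.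
  The rewards \<open>F (x \<delta>)\<close> move with \<delta>, so the expansion of the inner
  optimizer must be uniform over all rewards below a common bound; and \<open>x \<delta>\<close>
  must be shown to converge to \<open>x 0\<close>. On the robust side convergence follows from
  strict concavity of the mean. The optimistic objective is a supremum of concave functions, which
  need not be concave and could be infinite; a solution at one negative parameter tames it. The
  envelope step differentiates no value function: \<open>x\<close> is tested against
  \<open>x + t W\<close>, where \<open>W\<close> is the very expression to be bounded. The rate
  \<open>x \<delta> - x 0 = O(\<delta>)\<close> is secured by absorption before the linearized
  equation is solved, and the sign of the quadratic form is read off from cyclic monotonicity of a
  concave gradient.\<close>

definition emp_var :: "real^'n \<Rightarrow> ('n \<Rightarrow> real) \<Rightarrow> real" where
  "emp_var p v = emp_cov p v v"

lemma prob_vectorsD: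
  assumes "q \<in> prob_vectors"
  shows "0 \<le> q $ i" "(\<Sum>i\<in>UNIV. q $ i) = 1" "q $ i \<le> 1"
proof -
  show nn: "0 \<le> q $ i" for i using assms by (simp add: prob_vectors_def)
  show s: "(\<Sum>i\<in>UNIV. q $ i) = 1" using assms by (simp add: prob_vectors_def)
  show "q $ i \<le> 1" using member_le_sum[of i UNIV "\<lambda>i. q $ i"] nn s by simp
qed

lemma emp_mean_const [simp]: "q \<in> prob_vectors \<Longrightarrow> emp_mean q (\<lambda>_. c) = c"
  by (simp add: emp_mean_def prob_vectorsD(2) flip: scaleR_left.sum)

lemma emp_mean_add: "emp_mean q (\<lambda>i. g i + h i) = emp_mean q g + emp_mean q h"
  by (simp add: emp_mean_def scaleR_add_right sum.distrib)

lemma emp_mean_diff: "emp_mean q (\<lambda>i. g i - h i) = emp_mean q g - emp_mean q h"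
  by (simp add: emp_mean_def scaleR_diff_right sum_subtractf)

lemma emp_mean_minus: "emp_mean q (\<lambda>i. - h i) = - emp_mean q h"
  by (simp add: emp_mean_def sum_negf)

lemma emp_mean_scale: "emp_mean q (\<lambda>i. c *\<^sub>R h i) = c *\<^sub>R emp_mean q h"
  by (simp add: emp_mean_def scaleR_sum_right mult.commute)

lemma emp_mean_mult: "emp_mean q (\<lambda>i. c * h i) = c * (emp_mean q h :: real)"
  using emp_mean_scale[of q c h] by simp

lemma emp_mean_mono:
  fixes g h :: "'n::finite \<Rightarrow> real"
  assumes "q \<in> prob_vectors" "\<And>i. g i \<le> h i"
  shows "emp_mean q g \<le> emp_mean q h"
  unfolding emp_mean_def using assms prob_vectorsD(1) by (auto intro!: sum_mono mult_left_mono)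

lemma norm_emp_mean_le:
  fixes h :: "'n::finite \<Rightarrow> 'a::real_normed_vector"
  assumes "q \<in> prob_vectors" "\<And>i. norm (h i) \<le> B"
  shows "norm (emp_mean q h) \<le> B"
proof -
  have "norm (emp_mean q h) \<le> (\<Sum>i\<in>UNIV. norm (q $ i *\<^sub>R h i))"
    unfolding emp_mean_def by (rule norm_sum)
  also have "\<dots> = emp_mean q (\<lambda>i. norm (h i))"
    using prob_vectorsD(1)[OF assms(1)] by (simp add: emp_mean_def)
  also have "\<dots> \<le> emp_mean q (\<lambda>_. B)" using assms by (intro emp_mean_mono)
  finally show ?thesis using assms(1) by simp
qed

text \<open>Centring one factor is enough: the constant \<open>emp_mean p g\<close> is weighted by
  \<open>h i - emp_mean p h\<close>, whose mean is zero.\<close>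

lemma emp_cov_eq:
  fixes g :: "'n::finite \<Rightarrow> 'a::real_vector"
  assumes "p \<in> prob_vectors"
  shows "emp_cov p g h = emp_mean p (\<lambda>i. (h i - emp_mean p h) *\<^sub>R g i)"
proof -
  have "emp_mean p (\<lambda>i. (h i - emp_mean p h) *\<^sub>R emp_mean p g) = 0"
  proof -
    have "emp_mean p (\<lambda>i. (h i - emp_mean p h) *\<^sub>R emp_mean p g)
        = emp_mean p (\<lambda>i. h i - emp_mean p h) *\<^sub>R emp_mean p g"
      by (simp add: emp_mean_def scaleR_left.sum)
    then show ?thesis using assms by (simp add: emp_mean_diff)
  qed
  then show ?thesis
    by (simp add: emp_cov_def scaleR_diff_right emp_mean_diff)
qed

section \<open>The inner problem near the empirical distribution\<close>

text \<open>A predicate instead of a choice of minimizer, so that uniqueness never matters. The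
  optimistic problem is covered as well, with \<open>- v\<close> and \<open>- \<delta>\<close> in
  place of \<open>v\<close> and \<epsilon>.\<close>

definition inner_min :: "(real \<Rightarrow> ereal) \<Rightarrow> real^'n \<Rightarrow> ('n \<Rightarrow> real) \<Rightarrow> real \<Rightarrow> real^'n \<Rightarrow> bool" where
  "inner_min \<phi> p v \<epsilon> q \<longleftrightarrow>
     q \<in> prob_vectors \<and> (\<forall>q'\<in>prob_vectors. penalized \<phi> p v \<epsilon> q \<le> penalized \<phi> p v \<epsilon> q')"

text \<open>The radius is capped by 1 so that a ratio within \<open>e\<close> of 1 is positive; a
  vector whose ratios to \<open>p\<close> are that close therefore keeps nonnegative entries when it
  is perturbed inside the simplex.\<close>

locale smooth_divergence =
  fixes \<phi> :: "real \<Rightarrow> ereal" and p :: "real^'n" and e :: real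
  assumes divergence: "divergence_function \<phi>"
    and p_prob: "p \<in> prob_vectors" and p_pos: "\<And>i. 0 < p $ i"
    and e_pos: "0 < e" and e_le: "e \<le> 1"
    and finite_near: "\<And>z. \<bar>z - 1\<bar> < e \<Longrightarrow> \<phi> z \<noteq> \<infinity>"
    and differentiable_near: "\<And>z. \<bar>z - 1\<bar> < e \<Longrightarrow> (\<lambda>z. real_of_ereal (\<phi> z)) differentiable (at z)"
    and deriv_differentiable_near:
      "\<And>z. \<bar>z - 1\<bar> < e \<Longrightarrow> deriv (\<lambda>z. real_of_ereal (\<phi> z)) differentiable (at z)"

lemma smooth_divergence_exists:
  assumes "divergence_function \<phi>" "p \<in> prob_vectors" "\<And>i. 0 < p $ i"
  obtains e where "smooth_divergence \<phi> p e"
proof -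
  let ?\<psi> = "\<lambda>z. real_of_ereal (\<phi> z)"
  obtain e where e: "e > 0" "\<forall>z\<in>ball 1 e. \<phi> z \<noteq> \<infinity>"
    "?\<psi> differentiable_on ball 1 e" "deriv ?\<psi> differentiable_on ball 1 e"
    using assms(1) unfolding divergence_function_def by blast
  have "\<And>z. \<bar>z - 1\<bar> < min e 1 \<Longrightarrow> z \<in> ball 1 e"
    by (auto simp: dist_real_def)
  moreover have "?\<psi> differentiable (at z)" "deriv ?\<psi> differentiable (at z)"
    if "z \<in> ball 1 e" for z
    using e(3,4) that by (metis at_within_open differentiable_on_def open_ball)+
  ultimately have "smooth_divergence \<phi> p (min e 1)"
    using assms e by unfold_locales auto
  then show ?thesis using that by blast
qed

context smooth_divergence
begin

section \<open>Local calculus of the divergence function at 1\<close>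

abbreviation \<psi> :: "real \<Rightarrow> real" where "\<psi> \<equiv> \<lambda>z. real_of_ereal (\<phi> z)"
abbreviation \<kappa> :: real where "\<kappa> \<equiv> deriv2 \<phi> 1"

lemma kappa_pos: "0 < \<kappa>" using divergence by (simp add: divergence_function_def)

lemma phi_one: "\<phi> 1 = 0" using divergence by (simp add: divergence_function_def)

lemma phi_nonneg: "0 \<le> \<phi> z"
proof (cases "0 \<le> z")
  case False
  then have "\<phi> z = \<infinity>" using divergence by (auto simp: divergence_function_def)
  then show ?thesis by simp
qed (use divergence in \<open>simp add: divergence_function_def\<close>)

lemma phi_convex:
  "0 \<le> u \<Longrightarrow> 0 \<le> v \<Longrightarrow> u + v = 1 \<Longrightarrow> \<phi> (u * x + v * y) \<le> ereal u * \<phi> x + ereal v * \<phi> y"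
  using divergence by (auto simp: divergence_function_def)

lemma phi_eq: "\<bar>z - 1\<bar> < e \<Longrightarrow> \<phi> z = ereal (\<psi> z)"
  using finite_near[of z] phi_nonneg[of z] by (cases "\<phi> z") auto

text \<open>\<open>real_of_ereal\<close> sends infinity to 0, so the sign is global although
  \<open>\<psi>\<close> represents \<open>\<phi>\<close> only where the latter is finite. The point
  1 is thus a minimum of \<open>\<psi>\<close>, which gives
  \<open>deriv \<psi> 1 = 0\<close>.\<close>

lemma psi_nonneg: "0 \<le> \<psi> z"
  using phi_nonneg[of z] by (simp add: real_of_ereal_pos)

lemma psi_deriv: "\<bar>z - 1\<bar> < e \<Longrightarrow> (\<psi> has_real_derivative deriv \<psi> z) (at z)"
  using differentiable_near DERIV_deriv_iff_real_differentiable by blast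

lemma psi_deriv2: "\<bar>z - 1\<bar> < e \<Longrightarrow> (deriv \<psi> has_real_derivative deriv2 \<phi> z) (at z)"
  using deriv_differentiable_near DERIV_deriv_iff_real_differentiable
  unfolding deriv2_def by blast

lemma deriv_psi_one: "deriv \<psi> 1 = 0"
  by (rule DERIV_local_min[OF psi_deriv e_pos]) (use e_pos psi_nonneg phi_one in auto)

lemma deriv_psi_little_o:
  assumes "0 < \<eta>"
  obtains r where "0 < r" "r < e" "\<And>z. \<bar>z - 1\<bar> \<le> r \<Longrightarrow> \<bar>deriv \<psi> z - \<kappa> * (z - 1)\<bar> \<le> \<eta> * \<bar>z - 1\<bar>"
proof -
  have "(deriv \<psi> has_derivative (\<lambda>h. \<kappa> * h)) (at 1)"
    using psi_deriv2[of 1] e_pos by (simp add: has_field_derivative_def)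
  then obtain d where d: "d > 0"
    "\<And>z. norm (z - 1) < d \<Longrightarrow> norm (deriv \<psi> z - deriv \<psi> 1 - \<kappa> * (z - 1)) \<le> \<eta> * norm (z - 1)"
    using assms unfolding has_derivative_at_alt by blast
  show ?thesis
    by (rule that[of "min (d/2) (e/2)"]) (use d e_pos deriv_psi_one in auto)
qed

text \<open>Mean value inequality for \<open>deriv \<psi> w - \<kappa> * w\<close> on the ball of
  radius \<open>\<bar>z - 1\<bar>\<close>: its derivative is at most
  \<open>L * \<bar>z - 1\<bar>\<close> there, and the length of the segment supplies the second
  factor.\<close>

lemma deriv_psi_quadratic:
  assumes "lipschitz_near (deriv2 \<phi>) 1"
  obtains r L where "0 < r" "0 \<le> L"
    "\<And>z. \<bar>z - 1\<bar> < r \<Longrightarrow> \<bar>deriv \<psi> z - \<kappa> * (z - 1)\<bar> \<le> L * \<bar>z - 1\<bar>^2"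
proof -
  obtain d L where d: "d > 0" and L: "L-lipschitz_on (ball 1 d) (deriv2 \<phi>)"
    using assms unfolding lipschitz_near_def by blast
  define r where "r = min d e"
  have L0: "0 \<le> L" using L lipschitz_on_nonneg by blast
  have "\<bar>deriv \<psi> z - \<kappa> * (z - 1)\<bar> \<le> L * \<bar>z - 1\<bar>^2" if z: "\<bar>z - 1\<bar> < r" for z
  proof -
    define B :: "real set" where "B = cball 1 \<bar>z - 1\<bar>"
    have "norm ((\<lambda>w. deriv \<psi> w - \<kappa> * w) z - (\<lambda>w. deriv \<psi> w - \<kappa> * w) 1) \<le> (L * \<bar>z - 1\<bar>) * norm (z - 1)"
    proof (rule field_differentiable_bound[where S = B])
      show "convex B" by (simp add: B_def)
      fix w assume w: "w \<in> B"
      then have w': "\<bar>w - 1\<bar> \<le> \<bar>z - 1\<bar>" by (auto simp: B_def dist_real_def)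
      then have "\<bar>w - 1\<bar> < e" using z by (auto simp: r_def)
      then show "((\<lambda>w. deriv \<psi> w - \<kappa> * w) has_field_derivative (deriv2 \<phi> w - \<kappa>)) (at w within B)"
        by (auto intro!: derivative_eq_intros has_field_derivative_at_within[OF psi_deriv2])
      have "dist (deriv2 \<phi> w) (deriv2 \<phi> 1) \<le> L * dist w 1"
        using w' z d by (intro lipschitz_onD[OF L]) (auto simp: r_def dist_real_def)
      also have "\<dots> \<le> L * \<bar>z - 1\<bar>"
        using w' L0 by (auto simp: dist_real_def intro!: mult_left_mono)
      finally show "norm (deriv2 \<phi> w - \<kappa>) \<le> L * \<bar>z - 1\<bar>"
        by (simp add: dist_real_def)
    qed (auto simp: B_def dist_real_def)
    then show ?thesis
      by (simp add: deriv_psi_one algebra_simps power2_eq_square)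
  qed
  then show ?thesis using that[of r L] d e_pos L0 by (auto simp: r_def)
qed

text \<open>That 1 is an isolated zero comes from \<open>0 < \<kappa>\<close>: with tolerance
  \<open>\<kappa>/2\<close> the linear term wins over the remainder, so
  \<open>deriv \<psi> z\<close> has the sign of \<open>z - 1\<close>, and the mean value theorem is
  applied on either side of 1.\<close>

lemma psi_pos_near:
  obtains r0 where "0 < r0" "r0 < e" "\<And>z. \<bar>z - 1\<bar> \<le> r0 \<Longrightarrow> z \<noteq> 1 \<Longrightarrow> 0 < \<psi> z"
proof -
  obtain r where r: "0 < r" "r < e"
    "\<And>z. \<bar>z - 1\<bar> \<le> r \<Longrightarrow> \<bar>deriv \<psi> z - \<kappa> * (z - 1)\<bar> \<le> \<kappa>/2 * \<bar>z - 1\<bar>"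
    using deriv_psi_little_o[of "\<kappa>/2"] kappa_pos by auto
  have sgn: "0 < deriv \<psi> z * (z - 1)" if "\<bar>z - 1\<bar> \<le> r" "z \<noteq> 1" for z
  proof -
    have "0 < \<kappa> / 2 * (z - 1)^2" using kappa_pos that by simp
    also have "\<dots> = \<kappa> * (z - 1) * (z - 1) - \<kappa>/2 * \<bar>z - 1\<bar> * \<bar>z - 1\<bar>"
      by (simp add: power2_eq_square abs_mult_self_eq mult.assoc)
    also have "\<dots> \<le> \<kappa> * (z - 1) * (z - 1) - \<bar>deriv \<psi> z - \<kappa> * (z - 1)\<bar> * \<bar>z - 1\<bar>"
      using r(3)[OF that(1)] by (intro diff_left_mono mult_right_mono) auto
    also have "\<dots> \<le> \<kappa> * (z - 1) * (z - 1) + (deriv \<psi> z - \<kappa> * (z - 1)) * (z - 1)"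
      using abs_ge_minus_self[of "(deriv \<psi> z - \<kappa> * (z - 1)) * (z - 1)"] unfolding abs_mult by linarith
    finally show ?thesis by (simp add: algebra_simps)
  qed
  have "0 < \<psi> z" if z: "\<bar>z - 1\<bar> \<le> r" "z \<noteq> 1" for z
  proof (cases "z > 1")
    case True
    obtain w where w: "1 < w" "w < z" "\<psi> z - \<psi> 1 = (z - 1) * deriv \<psi> w"
      using MVT2[of 1 z \<psi> "deriv \<psi>"] True z r psi_deriv by force
    then have "0 < deriv \<psi> w" using sgn[of w] z by (auto simp: zero_less_mult_iff)
    then show ?thesis using w True phi_one by auto
  next
    case False
    then have "z < 1" using z by auto
    then obtain w where w: "z < w" "w < 1" "\<psi> 1 - \<psi> z = (1 - z) * deriv \<psi> w"
      using MVT2[of z 1 \<psi> "deriv \<psi>"] z r psi_deriv by force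
    then have "deriv \<psi> w < 0" using sgn[of w] z by (auto simp: zero_less_mult_iff)
    then have "(1 - z) * deriv \<psi> w < 0" using \<open>z < 1\<close> by (simp add: mult_pos_neg)
    then show ?thesis using w phi_one by auto
  qed
  then show ?thesis using that r by blast
qed

text \<open>Convexity transports positivity from distance \<open>s\<close> outwards: the segment
  from 1 to a far \<open>z\<close> passes through a point \<open>w\<close> at distance
  \<open>s\<close> from 1, and \<open>\<phi> 1 = 0\<close> gives
  \<open>\<phi> w \<le> u \<phi> z \<le> \<phi> z\<close>.\<close>

lemma phi_bounded_below:
  assumes "0 < r"
  obtains c where "0 < c" "\<And>z. r \<le> \<bar>z - 1\<bar> \<Longrightarrow> ereal c \<le> \<phi> z"
proof -
  obtain r0 where r0: "0 < r0" "r0 < e" "\<And>z. \<bar>z - 1\<bar> \<le> r0 \<Longrightarrow> z \<noteq> 1 \<Longrightarrow> 0 < \<psi> z"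
    using psi_pos_near by blast
  define s where "s = min r r0"
  have s: "0 < s" "s \<le> r" "s \<le> r0" "s < e" using assms r0 by (auto simp: s_def)
  define c where "c = min (\<psi> (1 + s)) (\<psi> (1 - s))"
  have "0 < c" using s r0(3)[of "1+s"] r0(3)[of "1-s"] by (auto simp: c_def)
  moreover have "ereal c \<le> \<phi> z" if z: "r \<le> \<bar>z - 1\<bar>" for z
  proof -
    define u where "u = s / \<bar>z - 1\<bar>"
    have u: "0 < u" "u \<le> 1" using z s by (auto simp: u_def)
    define w where "w = (1 - u) * 1 + u * z"
    have wz: "w - 1 = u * (z - 1)" by (simp add: w_def algebra_simps)
    have "w = 1 + s \<or> w = 1 - s"
    proof (cases "z > 1")
      case True then have "u * (z - 1) = s" by (simp add: u_def)
      then show ?thesis using wz by auto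
    next
      case False
      then have "u * (z - 1) = - s" using z s by (simp add: u_def field_simps)
      then show ?thesis using wz by auto
    qed
    then have "ereal c \<le> \<phi> w" using phi_eq[of w] s by (auto simp: c_def)
    also have "\<dots> \<le> ereal (1 - u) * \<phi> 1 + ereal u * \<phi> z"
      unfolding w_def using u by (intro phi_convex) auto
    also have "\<dots> = ereal u * \<phi> z" by (simp add: phi_one)
    also have "\<dots> \<le> 1 * \<phi> z" using u phi_nonneg by (intro ereal_mult_right_mono) auto
    finally show ?thesis by simp
  qed
  ultimately show ?thesis using that by blast
qed

section \<open>The penalized objective near and away from the empirical distribution\<close>

lemma phi_divergence_nonneg: "0 \<le> phi_divergence \<phi> q p"
  unfolding phi_divergence_def
  using p_pos phi_nonneg by (intro sum_nonneg ereal_0_le_mult) (auto simp: less_imp_le)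

lemma phi_divergence_self: "phi_divergence \<phi> p p = 0"
proof -
  have "p $ i / p $ i = 1" for i using p_pos[of i] by simp
  then show ?thesis by (simp add: phi_divergence_def phi_one)
qed

lemma penalized_self: "penalized \<phi> p v \<delta> p = ereal (emp_mean p v)"
  by (simp add: penalized_def phi_divergence_self)

lemma penalized_ge: "0 < \<epsilon> \<Longrightarrow> ereal (emp_mean q v) \<le> penalized \<phi> p v \<epsilon> q"
  using phi_divergence_nonneg[of q] by (simp add: penalized_def ereal_0_le_mult add_increasing2)

text \<open>The symmetry that reduces the optimistic problem to the robust one: maximizing at a
  negative parameter is minimizing for the opposite rewards at the opposite parameter.\<close>

lemma penalized_minus: "penalized \<phi> p (\<lambda>i. - v i) (- \<delta>) q = - penalized \<phi> p v \<delta> q"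
  using phi_divergence_nonneg[of q]
  by (cases "phi_divergence \<phi> q p") (auto simp: penalized_def emp_mean_minus)

lemma penalized_le: "\<delta> < 0 \<Longrightarrow> penalized \<phi> p v \<delta> q \<le> ereal (emp_mean q v)"
  using penalized_ge[of "- \<delta>" q "\<lambda>i. - v i"] ereal_minus_le_minus[of "ereal (emp_mean q v)"]
  by (simp add: penalized_minus emp_mean_minus)

lemma penalized_eq:
  assumes "\<And>i. \<bar>q $ i / p $ i - 1\<bar> < e"
  shows "penalized \<phi> p v \<epsilon> q =
    ereal ((\<Sum>i\<in>UNIV. q $ i * v i) + 1/\<epsilon> * (\<Sum>i\<in>UNIV. p $ i * \<psi> (q $ i / p $ i)))"
proof -
  have "\<phi> (q $ i / p $ i) = ereal (\<psi> (q $ i / p $ i))" for i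
    by (rule phi_eq[OF assms])
  then have "phi_divergence \<phi> q p = ereal (\<Sum>i\<in>UNIV. p $ i * \<psi> (q $ i / p $ i))"
    unfolding phi_divergence_def by (metis (no_types, lifting) sum.cong sum_ereal times_ereal.simps(1))
  then show ?thesis by (simp add: penalized_def emp_mean_def)
qed

lemma phi_divergence_bounded_below:
  assumes "0 < r"
  obtains c where "0 < c"
    "\<And>q i. r \<le> \<bar>q $ i / p $ i - 1\<bar> \<Longrightarrow> ereal c \<le> phi_divergence \<phi> q p"
proof -
  obtain c where c: "0 < c" "\<And>z. r \<le> \<bar>z - 1\<bar> \<Longrightarrow> ereal c \<le> \<phi> z"
    using phi_bounded_below assms by blast
  \<comment> \<open>The smallest weight makes the lower bound independent of the offending
    coordinate; the other terms of the divergence are nonnegative.\<close>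
  define m where "m = Min (range (\<lambda>i. p $ i))"
  have m: "0 < m" "\<And>i. m \<le> p $ i" using p_pos by (auto simp: m_def)
  have "ereal (m * c) \<le> phi_divergence \<phi> q p" if q: "r \<le> \<bar>q $ i / p $ i - 1\<bar>" for q i
  proof -
    have "ereal (m * c) \<le> ereal (p $ i) * ereal c" using m(2)[of i] c by simp
    also have "\<dots> \<le> ereal (p $ i) * \<phi> (q $ i / p $ i)"
      using c(2)[OF q] p_pos[of i] by (intro ereal_mult_left_mono) auto
    also have "\<dots> \<le> phi_divergence \<phi> q p"
      unfolding phi_divergence_def
      using sum_mono2[of UNIV "{i}" "\<lambda>i. ereal (p $ i) * \<phi> (q $ i / p $ i)"] p_pos phi_nonneg
      by (simp add: less_imp_le)
    finally show ?thesis .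
  qed
  then show ?thesis using that[of "m * c"] m c by auto
qed

text \<open>Measured against \<open>p\<close>, which pays no penalty, \<open>q\<close> gains at most
  \<open>2 B\<close> in mean but pays at least \<open>c / \<epsilon>\<close>. The threshold depends
  on \<open>v\<close> only through \<open>B\<close>, which is the uniformity required for moving
  rewards; the absolute value and the \<open>+ 1\<close> keep its denominator positive.\<close>

lemma penalized_large_away:
  assumes "0 < r"
  obtains \<epsilon>0 where "0 < \<epsilon>0"
    "\<And>\<epsilon> v q i. 0 < \<epsilon> \<Longrightarrow> \<epsilon> < \<epsilon>0 \<Longrightarrow> (\<And>i. \<bar>v i\<bar> \<le> B) \<Longrightarrow> q \<in> prob_vectors \<Longrightarrow>
       r \<le> \<bar>q $ i / p $ i - 1\<bar> \<Longrightarrow> ereal (emp_mean p v) < penalized \<phi> p v \<epsilon> q"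
proof -
  obtain c where c: "0 < c"
    "\<And>q i. r \<le> \<bar>q $ i / p $ i - 1\<bar> \<Longrightarrow> ereal c \<le> phi_divergence \<phi> q p"
    using phi_divergence_bounded_below assms by blast
  define \<epsilon>0 where "\<epsilon>0 = c / (2 * \<bar>B\<bar> + 1)"
  have "0 < \<epsilon>0" using c by (auto simp: \<epsilon>0_def intro!: divide_pos_pos)
  moreover have "ereal (emp_mean p v) < penalized \<phi> p v \<epsilon> q"
    if h: "0 < \<epsilon>" "\<epsilon> < \<epsilon>0" "\<And>i. \<bar>v i\<bar> \<le> B" "q \<in> prob_vectors" "r \<le> \<bar>q $ i / p $ i - 1\<bar>"
    for \<epsilon> v q i
  proof -
    have b: "\<bar>emp_mean p v\<bar> \<le> B" "\<bar>emp_mean q v\<bar> \<le> B"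
      using norm_emp_mean_le[OF p_prob, of v B] norm_emp_mean_le[OF h(4), of v B] h(3) by auto
    have "\<epsilon> * (2 * \<bar>B\<bar> + 1) < c" using h(2) by (simp add: \<epsilon>0_def less_divide_eq)
    then have "2 * \<bar>B\<bar> + 1 < c / \<epsilon>" using h(1) by (simp add: less_divide_eq mult.commute)
    then have "ereal (emp_mean p v) < ereal (emp_mean q v) + ereal (1/\<epsilon>) * ereal c"
      using b by (simp)
    also have "\<dots> \<le> penalized \<phi> p v \<epsilon> q"
      unfolding penalized_def using c(2)[OF h(5)] h(1)
      by (intro add_left_mono ereal_mult_left_mono) auto
    finally show ?thesis .
  qed
  ultimately show ?thesis using that by blast
qed

lemma inner_min_near:
  assumes "inner_min \<phi> p v \<epsilon> q"
    and "r \<le> \<bar>q $ i / p $ i - 1\<bar> \<Longrightarrow> ereal (emp_mean p v) < penalized \<phi> p v \<epsilon> q"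
  shows "\<bar>q $ i / p $ i - 1\<bar> < r"
  using assms p_prob penalized_self[of v \<epsilon>] unfolding inner_min_def
  by (metis leD not_le)

text \<open>Compactness is used only on the set \<open>K\<close> of ratios within \<open>r\<close>
  of 1, where the penalized objective is finite and continuous; \<open>p\<close> lies in
  \<open>K\<close> and already beats everything outside it.\<close>

lemma inner_min_exists:
  assumes "0 < r" "r < e"
    and away: "\<And>q i. q \<in> prob_vectors \<Longrightarrow> r \<le> \<bar>q $ i / p $ i - 1\<bar> \<Longrightarrow>
      ereal (emp_mean p v) < penalized \<phi> p v \<epsilon> q"
  shows "\<exists>q. inner_min \<phi> p v \<epsilon> q"
proof -
  define K where "K = {q \<in> prob_vectors. \<forall>i. \<bar>q $ i / p $ i - 1\<bar> \<le> r}"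
  define G where "G = (\<lambda>q::real^'n. (\<Sum>i\<in>UNIV. q $ i * v i) + 1/\<epsilon> * (\<Sum>i\<in>UNIV. p $ i * \<psi> (q $ i / p $ i)))"
  have pK: "p \<in> K"
  proof -
    have "p $ i / p $ i = 1" for i using p_pos[of i] by simp
    then show ?thesis using p_prob assms(1) by (simp add: K_def)
  qed
  have G: "penalized \<phi> p v \<epsilon> q = ereal (G q)" if "q \<in> K" for q
    unfolding G_def by (rule penalized_eq) (use that assms(2) in \<open>auto simp: K_def intro: le_less_trans\<close>)
  have "closed (prob_vectors :: (real^'n) set)"
    unfolding prob_vectors_def
    by (intro closed_Collect_conj closed_Collect_all closed_Collect_le closed_Collect_eq continuous_intros)
  moreover have "closed {q. \<forall>i. \<bar>q $ i / p $ i - 1\<bar> \<le> r}"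
    using p_pos by (intro closed_Collect_all closed_Collect_le continuous_intros) (auto simp: less_imp_neq[symmetric])
  ultimately have "closed K" unfolding K_def by (simp add: closed_Int Collect_conj_eq)
  moreover have "bounded K"
  proof -
    have "bounded (prob_vectors :: (real^'n) set)"
    proof (rule boundedI)
      fix q :: "real^'n" assume q: "q \<in> prob_vectors"
      have "norm q \<le> (\<Sum>i\<in>UNIV. \<bar>q $ i\<bar>)" by (rule norm_le_l1_cart)
      also have "\<dots> = 1" using prob_vectorsD[OF q] by simp
      finally show "norm q \<le> 1" .
    qed
    then show ?thesis by (rule bounded_subset) (auto simp: K_def)
  qed
  ultimately have "compact K" by (simp add: compact_eq_bounded_closed)
  moreover have "continuous_on K G"
  proof -
    have "continuous_on K (\<lambda>q. \<psi> (q $ i / p $ i))" for i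
    proof (rule continuous_on_compose2[of "{z. \<bar>z - 1\<bar> < e}" \<psi>])
      show "continuous_on {z. \<bar>z - 1\<bar> < e} \<psi>"
        by (intro continuous_at_imp_continuous_on ballI) (use psi_deriv DERIV_isCont in blast)
      show "continuous_on K (\<lambda>q. q $ i / p $ i)"
        using p_pos[of i] by (intro continuous_intros) auto
      show "(\<lambda>q. q $ i / p $ i) ` K \<subseteq> {z. \<bar>z - 1\<bar> < e}"
        using assms(2) by (auto simp: K_def intro: le_less_trans)
    qed
    then show ?thesis unfolding G_def by (intro continuous_intros)
  qed
  ultimately obtain q where q: "q \<in> K" "\<And>q'. q' \<in> K \<Longrightarrow> G q \<le> G q'"
    using continuous_attains_inf[of K G] pK by blast
  have "penalized \<phi> p v \<epsilon> q \<le> penalized \<phi> p v \<epsilon> q'" if q': "q' \<in> prob_vectors" for q'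
  proof (cases "q' \<in> K")
    case True
    then show ?thesis using q G by simp
  next
    case False
    then obtain i where "r < \<bar>q' $ i / p $ i - 1\<bar>" using q' by (auto simp: K_def not_le)
    then have "r \<le> \<bar>q' $ i / p $ i - 1\<bar>" by simp
    then have "ereal (emp_mean p v) < penalized \<phi> p v \<epsilon> q'" using away q' by blast
    moreover have "penalized \<phi> p v \<epsilon> q \<le> ereal (emp_mean p v)"
      using q(2)[OF pK] G[OF q(1)] G[OF pK] penalized_self[of v \<epsilon>] by simp
    ultimately show ?thesis by (meson le_less_trans less_imp_le)
  qed
  then show ?thesis using q(1) by (auto simp: inner_min_def K_def)
qed

text \<open>The perturbation direction \<open>d i = p i * (w i - E w)\<close>, with \<open>w\<close> the scaled gradient of
  the penalized objective relative to \<open>p\<close>, turns stationarity into vanishing variance of \<open>w\<close>.\<close>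
lemma inner_min_stationary:
  assumes "0 < \<epsilon>" and min: "inner_min \<phi> p v \<epsilon> q" and near: "\<And>i. \<bar>q $ i / p $ i - 1\<bar> < e"
  defines "w \<equiv> \<lambda>i. deriv \<psi> (q $ i / p $ i) + \<epsilon> * v i"
  shows "w i = emp_mean p w"
proof -
  define d where "d = (\<lambda>i. p $ i * (w i - emp_mean p w))"
  define F where "F = (\<lambda>t. (\<Sum>i\<in>UNIV. (q $ i + t * d i) * v i) +
      1/\<epsilon> * (\<Sum>i\<in>UNIV. p $ i * \<psi> ((q $ i + t * d i) / p $ i)))"
  have q: "q \<in> prob_vectors" using min by (simp add: inner_min_def)
  have sum_d: "(\<Sum>i\<in>UNIV. d i) = 0"
  proof -
    have "(\<Sum>i\<in>UNIV. d i) = emp_mean p (\<lambda>i. w i - emp_mean p w)" by (simp add: d_def emp_mean_def)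
    then show ?thesis using p_prob by (simp add: emp_mean_diff)
  qed
  have "\<forall>\<^sub>F t in nhds 0. \<forall>i. \<bar>(q $ i + t * d i) / p $ i - 1\<bar> < e"
  proof (intro eventually_all_finite)
    fix i
    have "((\<lambda>t. \<bar>(q $ i + t * d i) / p $ i - 1\<bar>) \<longlongrightarrow> \<bar>(q $ i + 0 * d i) / p $ i - 1\<bar>) (nhds 0)"
      using p_pos[of i] by (intro tendsto_intros filterlim_ident) auto
    then show "\<forall>\<^sub>F t in nhds 0. \<bar>(q $ i + t * d i) / p $ i - 1\<bar> < e"
      using near[of i] by (intro order_tendstoD) auto
  qed
  then obtain \<rho> where \<rho>: "\<rho> > 0" "\<And>t i. \<bar>t\<bar> < \<rho> \<Longrightarrow> \<bar>(q $ i + t * d i) / p $ i - 1\<bar> < e"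
    unfolding eventually_nhds_metric by (auto simp: dist_real_def)
  \<comment> \<open>Closeness to 1 is strict in finitely many coordinates, so small \<open>t\<close>
    of either sign is admissible, and the two-sided minimum at 0 makes the derivative of
    \<open>F\<close> vanish there.\<close>
  have "F 0 \<le> F t" if t: "\<bar>t\<bar> < \<rho>" for t
  proof -
    define q' where "q' = (\<chi> i. q $ i + t * d i)"
    have nr: "\<bar>q' $ i / p $ i - 1\<bar> < e" for i using \<rho>(2)[OF t] by (simp add: q'_def)
    have "0 \<le> q' $ i" for i
    proof -
      have "0 < q' $ i / p $ i" using nr[of i] e_le by linarith
      then show ?thesis using p_pos[of i] by (simp add: zero_less_divide_iff)
    qed
    moreover have "(\<Sum>i\<in>UNIV. q' $ i) = 1"
      using sum_d prob_vectorsD(2)[OF q] by (simp add: q'_def sum.distrib flip: sum_distrib_left)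
    ultimately have "q' \<in> prob_vectors" by (simp add: prob_vectors_def)
    then have "penalized \<phi> p v \<epsilon> q \<le> penalized \<phi> p v \<epsilon> q'" using min by (simp add: inner_min_def)
    then show ?thesis
      unfolding penalized_eq[OF near] penalized_eq[OF nr] by (simp add: F_def q'_def)
  qed
  moreover have "(F has_real_derivative (\<Sum>i\<in>UNIV. d i * v i) + 1/\<epsilon> * (\<Sum>i\<in>UNIV. d i * deriv \<psi> (q $ i / p $ i))) (at 0)"
  proof -
    have "((\<lambda>t. p $ i * \<psi> ((q $ i + t * d i) / p $ i)) has_real_derivative d i * deriv \<psi> (q $ i / p $ i)) (at 0)" for i
    proof -
      have a: "((\<lambda>t. (q $ i + t * d i) / p $ i) has_real_derivative d i / p $ i) (at 0)"
        using p_pos[of i] by (auto intro!: derivative_eq_intros)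
      have "(\<psi> has_real_derivative deriv \<psi> (q $ i / p $ i)) (at ((q $ i + 0 * d i) / p $ i))"
        using psi_deriv[OF near[of i]] by simp
      from DERIV_chain2[OF this a]
      have "((\<lambda>t. p $ i * \<psi> ((q $ i + t * d i) / p $ i)) has_real_derivative
          p $ i * (deriv \<psi> (q $ i / p $ i) * (d i / p $ i))) (at 0)"
        by (rule DERIV_cmult)
      then show ?thesis using p_pos[of i] by (simp add: mult.commute)
    qed
    then show ?thesis unfolding F_def
      by (intro DERIV_add DERIV_cmult DERIV_sum) (auto intro!: derivative_eq_intros)
  qed
  ultimately have "(\<Sum>i\<in>UNIV. d i * v i) + 1/\<epsilon> * (\<Sum>i\<in>UNIV. d i * deriv \<psi> (q $ i / p $ i)) = 0"
    using \<rho>(1) by (intro DERIV_local_min[of F _ 0 \<rho>]) auto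
  then have "\<epsilon> * ((\<Sum>i\<in>UNIV. d i * v i) + 1/\<epsilon> * (\<Sum>i\<in>UNIV. d i * deriv \<psi> (q $ i / p $ i))) = 0"
    by simp
  then have "(\<Sum>i\<in>UNIV. d i * w i) = 0"
    using assms(1) by (simp add: w_def algebra_simps sum.distrib sum_distrib_left)
  moreover have "(\<Sum>i\<in>UNIV. d i * w i) = (\<Sum>i\<in>UNIV. p $ i * (w i - emp_mean p w)^2)"
  proof -
    have "(\<Sum>i\<in>UNIV. d i * w i) = (\<Sum>i\<in>UNIV. d i * w i) - (\<Sum>i\<in>UNIV. d i) * emp_mean p w"
      using sum_d by simp
    also have "\<dots> = (\<Sum>i\<in>UNIV. d i * (w i - emp_mean p w))"
      by (simp add: sum_distrib_right sum_subtractf right_diff_distrib)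
    finally show ?thesis by (simp add: d_def power2_eq_square mult.assoc)
  qed
  ultimately have "p $ i * (w i - emp_mean p w)^2 = 0"
    using sum_nonneg_eq_0_iff[of UNIV "\<lambda>i. p $ i * (w i - emp_mean p w)^2"] p_pos
    by (simp add: less_imp_le)
  then show ?thesis using p_pos[of i] by simp
qed

text \<open>A remainder of \<open>deriv \<psi>\<close> bounded by \<open>\<kappa> / 4\<close> times the deviation can be absorbed, which
  yields the a priori bound on the likelihood ratios.\<close>
lemma inner_min_expansion_aux:
  assumes "0 < \<epsilon>" and min: "inner_min \<phi> p v \<epsilon> q" and v: "\<And>i. \<bar>v i\<bar> \<le> B"
    and r: "r \<le> e" and near: "\<And>i. \<bar>q $ i / p $ i - 1\<bar> < r"
    and rem: "\<And>z. \<bar>z - 1\<bar> < r \<Longrightarrow> \<bar>deriv \<psi> z - \<kappa> * (z - 1)\<bar> \<le> \<eta> * \<bar>z - 1\<bar>"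
    and "\<eta> \<le> \<kappa> / 4"
  shows "\<bar>q $ i / p $ i - 1\<bar> \<le> 4 * B * \<epsilon> / \<kappa>"
    and "(\<And>j. \<bar>deriv \<psi> (q $ j / p $ j) - \<kappa> * (q $ j / p $ j - 1)\<bar> \<le> T) \<Longrightarrow>
      \<bar>q $ i - p $ i * (1 - \<epsilon> / \<kappa> * (v i - emp_mean p v))\<bar> \<le> 2 * T / \<kappa>"
proof -
  define u where "u = (\<lambda>i. q $ i / p $ i)"
  define \<rho> where "\<rho> = (\<lambda>i. deriv \<psi> (u i) - \<kappa> * (u i - 1))"
  have q: "q \<in> prob_vectors" using min by (simp add: inner_min_def)
  have near': "\<And>i. \<bar>q $ i / p $ i - 1\<bar> < e" using near r by (meson less_le_trans)
  have mean_u: "emp_mean p (\<lambda>i. u i - 1) = 0"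
  proof -
    have "p $ i * u i = q $ i" for i using p_pos[of i] by (simp add: u_def)
    then have "emp_mean p u = 1" using prob_vectorsD(2)[OF q] by (simp add: emp_mean_def)
    then show ?thesis using p_prob by (simp add: emp_mean_diff)
  qed
  \<comment> \<open>Stationarity minus its \<open>p\<close>-average. The linear term has mean zero
    by \<open>mean_u\<close>, so only the fluctuation of the remainder survives; its two terms cause
    the factor 2 in \<open>dev\<close>.\<close>
  have key: "\<kappa> * (u i - 1) + \<epsilon> * (v i - emp_mean p v) = emp_mean p \<rho> - \<rho> i" for i
  proof -
    have "(\<lambda>i. deriv \<psi> (u i) + \<epsilon> * v i) = (\<lambda>i. (\<kappa> * (u i - 1) + \<rho> i) + \<epsilon> * v i)"
      by (simp add: \<rho>_def)
    then have "emp_mean p (\<lambda>i. deriv \<psi> (u i) + \<epsilon> * v i) = emp_mean p \<rho> + \<epsilon> * emp_mean p v"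
      by (simp add: emp_mean_add emp_mean_mult mean_u)
    then have "deriv \<psi> (u i) + \<epsilon> * v i = emp_mean p \<rho> + \<epsilon> * emp_mean p v"
      using inner_min_stationary[OF assms(1) min near', of i] by (simp add: u_def)
    then show ?thesis by (simp add: \<rho>_def algebra_simps)
  qed
  have mean_v: "\<bar>emp_mean p v\<bar> \<le> B" using norm_emp_mean_le[OF p_prob, of v B] v by simp
  have dev: "\<bar>\<kappa> * (u i - 1) + \<epsilon> * (v i - emp_mean p v)\<bar> \<le> 2 * T" if "\<And>j. \<bar>\<rho> j\<bar> \<le> T" for i T
  proof -
    have "\<bar>emp_mean p \<rho>\<bar> \<le> T" using norm_emp_mean_le[OF p_prob, of \<rho> T] that by simp
    then show ?thesis using key[of i] that[of i] by linarith
  qed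
  show "\<bar>q $ i / p $ i - 1\<bar> \<le> 4 * B * \<epsilon> / \<kappa>"
  proof -
    \<comment> \<open>At an index of largest deviation \<open>M\<close> the estimate reads
      \<open>\<kappa> M \<le> \<kappa>/2 M + 2 B \<epsilon>\<close>. The threshold
      \<open>\<kappa>/4\<close>, doubled by \<open>dev\<close>, leaves half of the left side to be
      absorbed, whence the constant \<open>4 B \<epsilon> / \<kappa>\<close>.\<close>
    define M where "M = Max (range (\<lambda>i. \<bar>u i - 1\<bar>))"
    have M: "\<And>i. \<bar>u i - 1\<bar> \<le> M" by (simp add: M_def)
    obtain k where k: "\<bar>u k - 1\<bar> = M"
      using Max_in[of "range (\<lambda>i. \<bar>u i - 1\<bar>)"] unfolding M_def by fastforce
    have "\<bar>\<rho> j\<bar> \<le> \<kappa> / 4 * M" for j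
    proof -
      have "\<bar>\<rho> j\<bar> \<le> \<eta> * \<bar>u j - 1\<bar>" using rem[OF near[of j]] by (simp add: \<rho>_def u_def)
      also have "\<dots> \<le> \<kappa> / 4 * M" using assms(7) M[of j] kappa_pos by (intro mult_mono) auto
      finally show ?thesis .
    qed
    then have "\<bar>\<kappa> * (u k - 1) + \<epsilon> * (v k - emp_mean p v)\<bar> \<le> 2 * (\<kappa> / 4 * M)" by (rule dev)
    moreover have "\<bar>\<epsilon> * (v k - emp_mean p v)\<bar> \<le> \<epsilon> * (2 * B)"
      unfolding abs_mult using assms(1) v[of k] mean_v by (intro mult_mono) auto
    ultimately have "\<bar>\<kappa> * (u k - 1)\<bar> \<le> \<kappa> / 2 * M + \<epsilon> * (2 * B)" by linarith
    then have "\<kappa> * M \<le> \<kappa> / 2 * M + \<epsilon> * (2 * B)" using k kappa_pos by (simp add: abs_mult)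
    then have "M \<le> 4 * B * \<epsilon> / \<kappa>" using kappa_pos by (simp add: field_simps)
    then show ?thesis using M[of i] by (simp add: u_def)
  qed
  show "\<bar>q $ i - p $ i * (1 - \<epsilon> / \<kappa> * (v i - emp_mean p v))\<bar> \<le> 2 * T / \<kappa>"
    if "\<And>j. \<bar>deriv \<psi> (q $ j / p $ j) - \<kappa> * (q $ j / p $ j - 1)\<bar> \<le> T"
  proof -
    have T: "\<bar>\<kappa> * (u i - 1) + \<epsilon> * (v i - emp_mean p v)\<bar> \<le> 2 * T"
      by (rule dev) (use that in \<open>simp add: \<rho>_def u_def\<close>)
    have "q $ i - p $ i * (1 - \<epsilon> / \<kappa> * (v i - emp_mean p v))
        = p $ i * ((\<kappa> * (u i - 1) + \<epsilon> * (v i - emp_mean p v)) / \<kappa>)"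
      using p_pos[of i] kappa_pos by (simp add: u_def field_simps)
    also have "\<bar>\<dots>\<bar> \<le> 1 * (2 * T / \<kappa>)"
      unfolding abs_mult using p_pos[of i] prob_vectorsD(3)[OF p_prob, of i] T kappa_pos
      by (intro mult_mono) (auto simp: divide_right_mono)
    finally show ?thesis by simp
  qed
qed

text \<open>Uniform in the rewards, and about all minimizers rather than a selected one. The error
  level \<open>E\<close> stays a parameter so that the regimes \<open>o(\<epsilon>)\<close> and
  \<open>O(\<epsilon>^2)\<close> share every later argument.\<close>

definition inner_expansion :: "real \<Rightarrow> real \<Rightarrow> real \<Rightarrow> bool" where
  "inner_expansion B \<epsilon> E \<longleftrightarrow> (\<forall>v. (\<forall>i. \<bar>v i\<bar> \<le> B) \<longrightarrow>
     (\<exists>q. inner_min \<phi> p v \<epsilon> q) \<and>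
     (\<forall>q. inner_min \<phi> p v \<epsilon> q \<longrightarrow>
        (\<forall>i. \<bar>q $ i - p $ i * (1 - \<epsilon> / \<kappa> * (v i - emp_mean p v))\<bar> \<le> E)))"

lemma inner_expansion_little_o:
  assumes "0 < \<eta>"
  shows "\<forall>\<^sub>F \<epsilon> in at_right 0. inner_expansion B \<epsilon> (\<eta> * \<epsilon>)"
proof -
  \<comment> \<open>The entry \<open>\<kappa>/4\<close> is the absorption threshold. The other makes
    the final error \<open>8 B \<eta>' \<epsilon> / \<kappa>^2\<close> at most
    \<open>\<eta> \<epsilon>\<close>: the factor 8 is 4 from the bound on the ratios times 2 from
    the expansion.\<close>
  define \<eta>' where "\<eta>' = min (\<kappa> / 4) (\<eta> * \<kappa>^2 / (8 * (\<bar>B\<bar> + 1)))"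
  have "\<eta>' \<le> \<kappa> / 4" by (simp only: \<eta>'_def min.cobounded1)
  then have \<eta>': "0 < \<eta>'" "\<eta>' \<le> \<kappa> / 4" "8 * (\<bar>B\<bar> + 1) * \<eta>' \<le> \<eta> * \<kappa>^2"
  proof -
    have "\<eta>' \<le> \<eta> * \<kappa>^2 / (8 * (\<bar>B\<bar> + 1))" by (simp add: \<eta>'_def)
    then show "8 * (\<bar>B\<bar> + 1) * \<eta>' \<le> \<eta> * \<kappa>^2" by (simp add: le_divide_eq mult.commute split: if_splits)
  qed (use assms kappa_pos in \<open>auto simp: \<eta>'_def\<close>)
  obtain r where r: "0 < r" "r < e"
    "\<And>z. \<bar>z - 1\<bar> \<le> r \<Longrightarrow> \<bar>deriv \<psi> z - \<kappa> * (z - 1)\<bar> \<le> \<eta>' * \<bar>z - 1\<bar>"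
    using deriv_psi_little_o[OF \<eta>'(1)] by blast
  obtain \<epsilon>0 where \<epsilon>0: "0 < \<epsilon>0"
    "\<And>\<epsilon> v q i. 0 < \<epsilon> \<Longrightarrow> \<epsilon> < \<epsilon>0 \<Longrightarrow> (\<And>i. \<bar>v i\<bar> \<le> B) \<Longrightarrow> q \<in> prob_vectors \<Longrightarrow>
       r \<le> \<bar>q $ i / p $ i - 1\<bar> \<Longrightarrow> ereal (emp_mean p v) < penalized \<phi> p v \<epsilon> q"
    using penalized_large_away[OF r(1)] by metis
  have "inner_expansion B \<epsilon> (\<eta> * \<epsilon>)" if \<epsilon>: "0 < \<epsilon>" "\<epsilon> < \<epsilon>0" for \<epsilon>
    unfolding inner_expansion_def
  proof (intro allI impI conjI)
    fix v :: "'n \<Rightarrow> real" assume v: "\<forall>i. \<bar>v i\<bar> \<le> B"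
    show "\<exists>q. inner_min \<phi> p v \<epsilon> q"
      by (rule inner_min_exists[OF r(1,2)]) (use \<epsilon>0(2) \<epsilon> v in blast)
    fix q i assume q: "inner_min \<phi> p v \<epsilon> q"
    then have qp: "q \<in> prob_vectors" by (simp add: inner_min_def)
    have near: "\<bar>q $ j / p $ j - 1\<bar> < r" for j
      by (rule inner_min_near[OF q]) (use \<epsilon>0(2) \<epsilon> v qp in blast)
    have rem: "\<bar>deriv \<psi> z - \<kappa> * (z - 1)\<bar> \<le> \<eta>' * \<bar>z - 1\<bar>" if "\<bar>z - 1\<bar> < r" for z
      using r(3)[of z] that by linarith
    have v': "\<And>i. \<bar>v i\<bar> \<le> B" using v by blast
    note aux = inner_min_expansion_aux[OF \<epsilon>(1) q v' less_imp_le[OF r(2)] near rem \<eta>'(2)]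
    have B: "0 \<le> B" using v by (meson abs_ge_zero order_trans)
    have "\<bar>deriv \<psi> (q $ j / p $ j) - \<kappa> * (q $ j / p $ j - 1)\<bar> \<le> \<eta>' * (4 * B * \<epsilon> / \<kappa>)" for j
      using rem[OF near[of j]] aux(1)[of j] \<eta>'(1) by (meson less_imp_le mult_left_mono order_trans)
    then have "\<bar>q $ i - p $ i * (1 - \<epsilon> / \<kappa> * (v i - emp_mean p v))\<bar> \<le> 2 * (\<eta>' * (4 * B * \<epsilon> / \<kappa>)) / \<kappa>"
      by (rule aux(2)[rotated])
    also have "\<dots> = (8 * B * \<eta>') * \<epsilon> / \<kappa>^2" by (simp add: power2_eq_square)
    also have "\<dots> \<le> (\<eta> * \<kappa>^2) * \<epsilon> / \<kappa>^2"
    proof -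
      have "8 * B * \<eta>' \<le> 8 * (\<bar>B\<bar> + 1) * \<eta>'" using \<eta>'(1) by (intro mult_right_mono) auto
      then have "8 * B * \<eta>' \<le> \<eta> * \<kappa>^2" using \<eta>'(3) by linarith
      then show ?thesis using \<epsilon> by (intro divide_right_mono mult_right_mono) auto
    qed
    finally show "\<bar>q $ i - p $ i * (1 - \<epsilon> / \<kappa> * (v i - emp_mean p v))\<bar> \<le> \<eta> * \<epsilon>"
      using kappa_pos by simp
  qed
  then show ?thesis unfolding eventually_at_right_field using \<epsilon>0(1) by blast
qed

text \<open>Two remainder bounds with different tasks: the linear one, with tolerance
  \<open>\<kappa>/4\<close>, yields ratios within \<open>O(\<epsilon>)\<close> of 1; inserting this
  in the quadratic one makes the remainder \<open>O(\<epsilon>^2)\<close>.\<close>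

lemma inner_expansion_quadratic:
  assumes "lipschitz_near (deriv2 \<phi>) 1"
  obtains C where "0 \<le> C" "\<forall>\<^sub>F \<epsilon> in at_right 0. inner_expansion B \<epsilon> (C * \<epsilon>^2)"
proof -
  obtain r1 where r1: "0 < r1" "r1 < e"
    "\<And>z. \<bar>z - 1\<bar> \<le> r1 \<Longrightarrow> \<bar>deriv \<psi> z - \<kappa> * (z - 1)\<bar> \<le> \<kappa> / 4 * \<bar>z - 1\<bar>"
    using deriv_psi_little_o[of "\<kappa> / 4"] kappa_pos by auto
  obtain r2 L where r2: "0 < r2" "0 \<le> L"
    "\<And>z. \<bar>z - 1\<bar> < r2 \<Longrightarrow> \<bar>deriv \<psi> z - \<kappa> * (z - 1)\<bar> \<le> L * \<bar>z - 1\<bar>^2"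
    using deriv_psi_quadratic[OF assms] by blast
  define r where "r = min r1 r2"
  have r: "0 < r" "r < e" using r1 r2 by (auto simp: r_def)
  define C where "C = 2 * (L * (4 * B / \<kappa>)^2) / \<kappa>"
  have C: "0 \<le> C" using r2 kappa_pos by (simp add: C_def)
  obtain \<epsilon>0 where \<epsilon>0: "0 < \<epsilon>0"
    "\<And>\<epsilon> v q i. 0 < \<epsilon> \<Longrightarrow> \<epsilon> < \<epsilon>0 \<Longrightarrow> (\<And>i. \<bar>v i\<bar> \<le> B) \<Longrightarrow> q \<in> prob_vectors \<Longrightarrow>
       r \<le> \<bar>q $ i / p $ i - 1\<bar> \<Longrightarrow> ereal (emp_mean p v) < penalized \<phi> p v \<epsilon> q"
    using penalized_large_away[OF r(1)] by metis
  have "inner_expansion B \<epsilon> (C * \<epsilon>^2)" if \<epsilon>: "0 < \<epsilon>" "\<epsilon> < \<epsilon>0" for \<epsilon>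
    unfolding inner_expansion_def
  proof (intro allI impI conjI)
    fix v :: "'n \<Rightarrow> real" assume v: "\<forall>i. \<bar>v i\<bar> \<le> B"
    show "\<exists>q. inner_min \<phi> p v \<epsilon> q"
      by (rule inner_min_exists[OF r(1,2)]) (use \<epsilon>0(2) \<epsilon> v in blast)
    fix q i assume q: "inner_min \<phi> p v \<epsilon> q"
    then have qp: "q \<in> prob_vectors" by (simp add: inner_min_def)
    have near: "\<bar>q $ j / p $ j - 1\<bar> < r" for j
      by (rule inner_min_near[OF q]) (use \<epsilon>0(2) \<epsilon> v qp in blast)
    have rem: "\<bar>deriv \<psi> z - \<kappa> * (z - 1)\<bar> \<le> \<kappa> / 4 * \<bar>z - 1\<bar>" if "\<bar>z - 1\<bar> < r" for z
      using r1(3)[of z] that by (simp add: r_def)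
    have v': "\<And>i. \<bar>v i\<bar> \<le> B" using v by blast
    note aux = inner_min_expansion_aux[OF \<epsilon>(1) q v' less_imp_le[OF r(2)] near rem order_refl]
    have "\<bar>deriv \<psi> (q $ j / p $ j) - \<kappa> * (q $ j / p $ j - 1)\<bar> \<le> L * (4 * B * \<epsilon> / \<kappa>)^2" for j
    proof -
      have "\<bar>deriv \<psi> (q $ j / p $ j) - \<kappa> * (q $ j / p $ j - 1)\<bar> \<le> L * \<bar>q $ j / p $ j - 1\<bar>^2"
        using r2(3) near[of j] by (simp add: r_def)
      also have "\<dots> \<le> L * (4 * B * \<epsilon> / \<kappa>)^2"
        using aux(1)[of j] r2(2) by (intro mult_left_mono power_mono) auto
      finally show ?thesis .
    qed
    then have "\<bar>q $ i - p $ i * (1 - \<epsilon> / \<kappa> * (v i - emp_mean p v))\<bar> \<le> 2 * (L * (4 * B * \<epsilon> / \<kappa>)^2) / \<kappa>"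
      by (rule aux(2)[rotated])
    also have "\<dots> = C * \<epsilon>^2" by (simp add: C_def power_mult_distrib power_divide)
    finally show "\<bar>q $ i - p $ i * (1 - \<epsilon> / \<kappa> * (v i - emp_mean p v))\<bar> \<le> C * \<epsilon>^2" .
  qed
  then have "\<forall>\<^sub>F \<epsilon> in at_right 0. inner_expansion B \<epsilon> (C * \<epsilon>^2)"
    unfolding eventually_at_right_field using \<epsilon>0(1) by blast
  then show ?thesis using that C by blast
qed

end

section \<open>Sensitivity of a fixed decision\<close>

context smooth_divergence
begin

lemma inner_expansionD:
  assumes "inner_expansion B \<epsilon> E" "\<And>i. \<bar>v i\<bar> \<le> B"
  shows "\<exists>q. inner_min \<phi> p v \<epsilon> q"
    and "inner_min \<phi> p v \<epsilon> q \<Longrightarrow> \<bar>q $ i - p $ i * (1 - \<epsilon> / \<kappa> * (v i - emp_mean p v))\<bar> \<le> E"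
  using assms unfolding inner_expansion_def by blast+

text \<open>The expansion holds for every minimizer, so all that is asked of the choice inside
  \<open>arg_min_on\<close> is that a minimizer exists.\<close>

lemma worst_case_dist_inner_min:
  assumes "\<exists>q. inner_min \<phi> p v \<epsilon> q"
  shows "inner_min \<phi> p v \<epsilon> (worst_case_dist \<phi> p v \<epsilon>)"
proof -
  have "inner_min \<phi> p v \<epsilon> = is_arg_min (penalized \<phi> p v \<epsilon>) (\<lambda>q. q \<in> prob_vectors)"
    by (auto simp: inner_min_def is_arg_min_linorder fun_eq_iff)
  then show ?thesis
    using assms someI_ex unfolding worst_case_dist_def arg_min_on_def arg_min_def by metis
qed

theorem sensitivity_eq: "sensitivity \<phi> p v = emp_var p v / \<kappa>"
proof -
  define B where "B = (\<Sum>i\<in>UNIV. \<bar>v i\<bar>)"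
  have v: "\<bar>v i\<bar> \<le> B" for i unfolding B_def by (rule member_le_sum) auto
  have B: "0 \<le> B" by (simp add: B_def sum_nonneg)
  define Q where "Q = worst_case_dist \<phi> p v"
  have "((\<lambda>\<epsilon>. (emp_mean (Q \<epsilon>) v - emp_mean p v) / \<epsilon>) \<longlongrightarrow> - (emp_var p v / \<kappa>)) (at_right 0)"
  proof (rule tendstoI)
    fix s :: real assume s: "0 < s"
    \<comment> \<open>After division by \<epsilon> the error is at most \<open>\<eta> B\<close>,
      which has to stay below \<open>s\<close>; the \<open>+ 1\<close> covers rewards that are all
      zero.\<close>
    define \<eta> where "\<eta> = s / (B + 1)"
    have \<eta>: "0 < \<eta>" using s B by (simp add: \<eta>_def)
    have "\<eta> * B < s" using s B by (simp add: \<eta>_def field_simps)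
    have "\<forall>\<^sub>F \<epsilon> in at_right 0. 0 < \<epsilon> \<and> inner_expansion B \<epsilon> (\<eta> * \<epsilon>)"
      using inner_expansion_little_o[OF \<eta>] eventually_at_right_less by (rule eventually_elim2) auto
    then show "\<forall>\<^sub>F \<epsilon> in at_right 0. dist ((emp_mean (Q \<epsilon>) v - emp_mean p v) / \<epsilon>) (- (emp_var p v / \<kappa>)) < s"
    proof eventually_elim
      case (elim \<epsilon>)
      then have \<epsilon>: "0 < \<epsilon>" and ex: "inner_expansion B \<epsilon> (\<eta> * \<epsilon>)" by auto
      note D = inner_expansionD[OF ex v]
      have min: "inner_min \<phi> p v \<epsilon> (Q \<epsilon>)"
        unfolding Q_def by (rule worst_case_dist_inner_min[OF D(1)])
      define err where "err = (\<lambda>i. Q \<epsilon> $ i - p $ i * (1 - \<epsilon> / \<kappa> * (v i - emp_mean p v)))"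
      have err: "\<bar>err i\<bar> \<le> \<eta> * \<epsilon>" for i unfolding err_def by (rule D(2)[OF min])
      have "emp_mean (Q \<epsilon>) v - emp_mean p v + \<epsilon> * (emp_var p v / \<kappa>) = (\<Sum>i\<in>UNIV. err i * v i)"
      proof -
        define m where "m = emp_mean p v"
        have "(\<Sum>i\<in>UNIV. err i * v i)
            = (\<Sum>i\<in>UNIV. Q \<epsilon> $ i * v i - p $ i * v i + \<epsilon> / \<kappa> * (p $ i * ((v i - m) * v i)))"
          by (rule sum.cong) (auto simp: err_def m_def algebra_simps diff_divide_distrib)
        then show ?thesis
          unfolding emp_var_def emp_cov_eq[OF p_prob]
          by (simp add: emp_mean_def m_def sum.distrib sum_subtractf sum_distrib_left sum_divide_distrib)
      qed
      also have "\<bar>\<dots>\<bar> \<le> (\<Sum>i\<in>UNIV. \<bar>err i * v i\<bar>)" by (rule sum_abs)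
      also have "\<dots> \<le> (\<Sum>i\<in>UNIV. \<eta> * \<epsilon> * \<bar>v i\<bar>)"
        unfolding abs_mult by (intro sum_mono mult_right_mono err) auto
      also have "\<dots> = \<epsilon> * (\<eta> * B)" by (simp add: B_def sum_distrib_left mult_ac)
      also have "\<dots> < \<epsilon> * s" using \<epsilon> \<open>\<eta> * B < s\<close> by simp
      finally have *: "\<bar>emp_mean (Q \<epsilon>) v - emp_mean p v + \<epsilon> * (emp_var p v / \<kappa>)\<bar> < \<epsilon> * s" .
      have "(emp_mean (Q \<epsilon>) v - emp_mean p v) / \<epsilon> + emp_var p v / \<kappa>
          = (emp_mean (Q \<epsilon>) v - emp_mean p v + \<epsilon> * (emp_var p v / \<kappa>)) / \<epsilon>"
        using \<epsilon> by (simp add: add_divide_distrib)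
      then show ?case using * \<epsilon> by (simp add: dist_real_def divide_less_eq mult.commute)
    qed
  qed
  then show ?thesis
    unfolding sensitivity_def Q_def by (simp add: tendsto_Lim)
qed

section \<open>Objective values at inner optimizers\<close>

lemma objective_le: "0 < \<delta> \<Longrightarrow> q \<in> prob_vectors \<Longrightarrow> objective \<phi> p \<delta> v \<le> penalized \<phi> p v \<delta> q"
  by (simp add: objective_def INF_lower)

lemma objective_ge: "\<delta> < 0 \<Longrightarrow> q \<in> prob_vectors \<Longrightarrow> penalized \<phi> p v \<delta> q \<le> objective \<phi> p \<delta> v"
  by (simp add: objective_def SUP_upper)

lemma objective_eq_min:
  assumes "0 < \<delta>" "inner_min \<phi> p v \<delta> q"
  shows "objective \<phi> p \<delta> v = penalized \<phi> p v \<delta> q"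
  using assms by (intro antisym) (auto simp: objective_def inner_min_def intro: INF_lower INF_greatest)

lemma objective_eq_max:
  assumes "\<delta> < 0" "inner_min \<phi> p (\<lambda>i. - v i) (- \<delta>) q"
  shows "objective \<phi> p \<delta> v = penalized \<phi> p v \<delta> q"
  using assms
  by (intro antisym) (auto simp: objective_def inner_min_def penalized_minus intro: SUP_upper SUP_least)

text \<open>With the same \<open>q\<close> on both sides a finite penalty cancels. This converts a
  comparison of robust or optimistic values into one of plain means under a common
  \<open>q\<close>.\<close>

lemma penalized_cancel:
  assumes "penalized \<phi> p v \<delta> q \<le> penalized \<phi> p w \<delta> q" "phi_divergence \<phi> q p \<noteq> \<infinity>"
  shows "emp_mean q v \<le> emp_mean q w"
  using assms phi_divergence_nonneg[of q]
  by (cases "phi_divergence \<phi> q p") (auto simp: penalized_def)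

lemma phi_divergence_finite:
  assumes "0 < \<epsilon>" "inner_min \<phi> p v \<epsilon> q"
  shows "phi_divergence \<phi> q p \<noteq> \<infinity>"
proof
  assume "phi_divergence \<phi> q p = \<infinity>"
  then have "penalized \<phi> p v \<epsilon> q = \<infinity>" using assms(1) by (simp add: penalized_def)
  moreover have "penalized \<phi> p v \<epsilon> q \<le> ereal (emp_mean p v)"
    using assms(2) p_prob penalized_self[of v \<epsilon>] by (metis inner_min_def)
  ultimately show False by simp
qed

end

section \<open>Gradients\<close>

lemma has_derivative_grad:
  assumes "g differentiable (at x)"
  shows "(g has_derivative (\<lambda>h. grad g x \<bullet> h)) (at x)"
proof -
  define D where "D = frechet_derivative g (at x)"
  have D: "(g has_derivative D) (at x)" using assms frechet_derivative_works D_def by blast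
  then have lin: "linear D" by (simp add: has_derivative_linear)
  have "D h = grad g x \<bullet> h" for h
  proof -
    have "D h = D (\<Sum>i\<in>UNIV. h $ i *s axis i 1)" by (simp add: basis_expansion)
    also have "\<dots> = (\<Sum>i\<in>UNIV. h $ i * D (axis i 1))"
      using lin by (simp add: linear_sum linear_cmul scalar_mult_eq_scaleR)
    finally show ?thesis by (simp add: grad_def inner_vec_def D_def mult.commute)
  qed
  then show ?thesis using D by (metis (no_types, lifting) ext)
qed

lemma has_derivative_hessian:
  assumes "grad g differentiable (at x)"
  shows "(grad g has_derivative (\<lambda>h. hessian g x *v h)) (at x)"
  using assms by (simp add: hessian_def jacobian_works)

section \<open>Solutions of the robust and the optimistic problem\<close>

text \<open>One realization of the sample: \<open>F z i\<close> stands for the reward of decision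
  \<open>z\<close> in scenario \<open>i\<close>. The analysis inside is deterministic; probability
  only supplies the two assumptions almost surely.\<close>

locale scenario_problem = smooth_divergence \<phi> p e
  for \<phi> and p :: "real^'n" and e +
  fixes F :: "real^'d \<Rightarrow> 'n \<Rightarrow> real"
  assumes strictly_concave: "\<And>i. strictly_concave (\<lambda>z. F z i)"
    and smooth: "\<And>i. twice_cont_diff (\<lambda>z. F z i)"
begin

abbreviation DF :: "real^'d \<Rightarrow> 'n \<Rightarrow> real^'d" where "DF \<equiv> \<lambda>x i. grad (\<lambda>z. F z i) x"
abbreviation HF :: "real^'d \<Rightarrow> 'n \<Rightarrow> real^'d^'d" where "HF \<equiv> \<lambda>x i. hessian (\<lambda>z. F z i) x"

lemma F_deriv: "((\<lambda>z. F z i) has_derivative (\<lambda>h. DF x i \<bullet> h)) (at x)"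
  using smooth[of i] by (intro has_derivative_grad) (simp add: twice_cont_diff_def differentiable_on_def)

lemma DF_deriv: "((\<lambda>z. DF z i) has_derivative (\<lambda>h. HF x i *v h)) (at x)"
  using has_derivative_hessian[of "\<lambda>z. F z i" x] smooth[of i]
  by (simp add: twice_cont_diff_def differentiable_on_def)

lemma continuous_F: "continuous (at x) (\<lambda>z. F z i)"
  using F_deriv has_derivative_continuous by blast

lemma F_concave:
  assumes "0 < u" "0 < v" "u + v = 1"
  shows "u * F x i + v * F y i \<le> F (u *\<^sub>R x + v *\<^sub>R y) i"
proof (cases "x = y")
  case True
  then show ?thesis using assms by (simp flip: distrib_right scaleR_left_distrib)
next
  case False
  then show ?thesis using strictly_concave[of i] assms unfolding strictly_concave_def
    by (meson less_imp_le)
qed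

lemma emp_mean_concave:
  assumes "q \<in> prob_vectors" "0 < u" "0 < v" "u + v = 1"
  shows "u * emp_mean q (F x) + v * emp_mean q (F y) \<le> emp_mean q (F (u *\<^sub>R x + v *\<^sub>R y))"
proof -
  have "u * emp_mean q (F x) + v * emp_mean q (F y) = emp_mean q (\<lambda>i. u * F x i + v * F y i)"
    by (simp add: emp_mean_add emp_mean_mult)
  also have "\<dots> \<le> emp_mean q (F (u *\<^sub>R x + v *\<^sub>R y))"
    using assms F_concave by (intro emp_mean_mono) auto
  finally show ?thesis .
qed

lemma emp_mean_strictly_concave:
  assumes "x \<noteq> y" "0 < u" "0 < v" "u + v = 1"
  shows "u * emp_mean p (F x) + v * emp_mean p (F y) < emp_mean p (F (u *\<^sub>R x + v *\<^sub>R y))"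
proof -
  have "u * emp_mean p (F x) + v * emp_mean p (F y) = emp_mean p (\<lambda>i. u * F x i + v * F y i)"
    by (simp add: emp_mean_add emp_mean_mult)
  also have "\<dots> < emp_mean p (F (u *\<^sub>R x + v *\<^sub>R y))"
    unfolding emp_mean_def using p_pos strictly_concave assms unfolding strictly_concave_def
    by (intro sum_strict_mono) auto
  finally show ?thesis .
qed

lemma solves_zero: "solves \<phi> p F 0 x \<longleftrightarrow> (\<forall>z. emp_mean p (F z) \<le> emp_mean p (F x))"
  by (simp add: solves_def objective_def)

text \<open>Compares \<open>z\<close> with the solution \<open>z0\<close> at an inner optimizer \<open>q\<close>: the optimizer at \<open>z\<close> for
  the robust problem, the optimizer at \<open>z0\<close> for the optimistic one.\<close>
lemma solution_comparison:
  assumes sol: "solves \<phi> p F \<delta> z0" and "\<delta> \<noteq> 0" and ex: "inner_expansion B \<bar>\<delta>\<bar> E"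
    and z0: "\<And>i. \<bar>F z0 i\<bar> \<le> B" and z: "\<And>i. \<bar>F z i\<bar> \<le> B"
  shows "\<exists>q y. (y = z \<or> y = z0) \<and> emp_mean q (F z) \<le> emp_mean q (F z0) \<and>
    (\<forall>i. \<bar>q $ i - p $ i * (1 - \<delta> / \<kappa> * (F y i - emp_mean p (F y)))\<bar> \<le> E)"
proof (cases "\<delta> > 0")
  case True
  then have ex': "inner_expansion B \<delta> E" using ex by simp
  obtain q where q: "inner_min \<phi> p (F z) \<delta> q" using inner_expansionD(1)[OF ex', of "F z"] z by blast
  then have qp: "q \<in> prob_vectors" by (simp add: inner_min_def)
  have "penalized \<phi> p (F z) \<delta> q = objective \<phi> p \<delta> (F z)" using objective_eq_min[OF True q] by simp
  also have "\<dots> \<le> objective \<phi> p \<delta> (F z0)" using sol by (simp add: solves_def)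
  also have "\<dots> \<le> penalized \<phi> p (F z0) \<delta> q" by (rule objective_le[OF True qp])
  finally have "emp_mean q (F z) \<le> emp_mean q (F z0)"
    using phi_divergence_finite[OF True q] by (rule penalized_cancel)
  then show ?thesis using inner_expansionD(2)[OF ex', of "F z", OF z q] by blast
next
  case False
  then have neg: "\<delta> < 0" using assms(2) by simp
  then have ex': "inner_expansion B (- \<delta>) E" using ex by simp
  have z0': "\<And>i. \<bar>- F z0 i\<bar> \<le> B" using z0 by simp
  obtain q where q: "inner_min \<phi> p (\<lambda>i. - F z0 i) (- \<delta>) q" using inner_expansionD(1)[OF ex', of "\<lambda>i. - F z0 i"] z0' by blast
  then have qp: "q \<in> prob_vectors" by (simp add: inner_min_def)
  have "penalized \<phi> p (F z) \<delta> q \<le> objective \<phi> p \<delta> (F z)" by (rule objective_ge[OF neg qp])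
  also have "\<dots> \<le> objective \<phi> p \<delta> (F z0)" using sol by (simp add: solves_def)
  also have "\<dots> = penalized \<phi> p (F z0) \<delta> q" by (rule objective_eq_max[OF neg q])
  finally have "emp_mean q (F z) \<le> emp_mean q (F z0)"
    using phi_divergence_finite[OF _ q] neg by (intro penalized_cancel) auto
  \<comment> \<open>Both signs flip at once: \<open>- \<delta>\<close> times the centred
    \<open>- F z0\<close> is \<delta> times the centred \<open>F z0\<close>, so a single formula
    covers the robust and the optimistic case.\<close>
  moreover have "\<bar>q $ i - p $ i * (1 - \<delta> / \<kappa> * (F z0 i - emp_mean p (F z0)))\<bar> \<le> E" for i
    using inner_expansionD(2)[OF ex', of "\<lambda>i. - F z0 i", OF z0' q, of i] by (simp add: emp_mean_minus algebra_simps)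
  ultimately show ?thesis by blast
qed

text \<open>Moving from \<open>x\<close> to \<open>x + t W\<close> cannot raise the mean under the
  comparison weights \<open>q\<close>. Replacing \<open>q\<close> by its linearization costs at most
  \<open>E\<close> per scenario; dividing by \<open>t\<close> and letting \<open>t\<close> tend to 0
  with \<open>E\<close> fixed leaves
  \<open>W \<bullet> W \<le> E \<Sum> \<bar>DF x i \<bullet> W\<bar>\<close>. Choosing
  \<open>W\<close> itself as direction is what makes the left side a square.\<close>

theorem first_order_condition:
  assumes sol: "solves \<phi> p F \<delta> x" and "\<delta> \<noteq> 0" and ex: "inner_expansion B \<bar>\<delta>\<bar> E"
    and bound: "\<And>i. \<bar>F x i\<bar> < B"
  shows "norm (emp_mean p (DF x) - (\<delta> / \<kappa>) *\<^sub>R emp_cov p (DF x) (F x)) \<le> E * (\<Sum>i\<in>UNIV. norm (DF x i))"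
proof -
  define W where "W = emp_mean p (DF x) - (\<delta> / \<kappa>) *\<^sub>R emp_cov p (DF x) (F x)"
  \<comment> \<open>Linearized optimal weights for the reward at \<open>x + t W\<close>. At
    \<open>t = 0\<close> they are the weights under which the mean gradient equals
    \<open>W\<close>.\<close>
  define c where "c = (\<lambda>t i. p $ i * (1 - \<delta> / \<kappa> * (F (x + t *\<^sub>R W) i - emp_mean p (F (x + t *\<^sub>R W)))))"
  define D where "D = (\<lambda>t i. (F (x + t *\<^sub>R W) i - F x i) / t)"
  have W: "W = (\<Sum>i\<in>UNIV. c 0 i *\<^sub>R DF x i)"
  proof -
    have "W = emp_mean p (DF x) - (\<delta> / \<kappa>) *\<^sub>R emp_mean p (\<lambda>i. (F x i - emp_mean p (F x)) *\<^sub>R DF x i)"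
      unfolding W_def emp_cov_eq[OF p_prob] ..
    also have "\<dots> = emp_mean p (\<lambda>i. DF x i - (\<delta> / \<kappa>) *\<^sub>R ((F x i - emp_mean p (F x)) *\<^sub>R DF x i))"
      by (simp only: emp_mean_diff emp_mean_scale)
    also have "\<dots> = (\<Sum>i\<in>UNIV. c 0 i *\<^sub>R DF x i)"
      unfolding emp_mean_def[of p "\<lambda>i. _ i - _ i"] c_def by (intro sum.cong) (auto simp: algebra_simps)
    finally show ?thesis .
  qed
  have path: "((\<lambda>t. x + t *\<^sub>R W) \<longlongrightarrow> x) (at_right 0)"
  proof -
    have "((\<lambda>t. x + t *\<^sub>R W) \<longlongrightarrow> x + 0 *\<^sub>R W) (at_right 0)" by (intro tendsto_intros)
    then show ?thesis by simp
  qed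
  have F_path: "((\<lambda>t. F (x + t *\<^sub>R W) i) \<longlongrightarrow> F x i) (at_right 0)" for i
    using isCont_tendsto_compose[OF continuous_F path] .
  have c_lim: "((\<lambda>t. c t i) \<longlongrightarrow> c 0 i) (at_right 0)" for i
    unfolding c_def emp_mean_def using F_path kappa_pos by (auto intro!: tendsto_intros)
  have D_lim: "((\<lambda>t. D t i) \<longlongrightarrow> DF x i \<bullet> W) (at_right 0)" for i
  proof -
    have "((\<lambda>t. x + t *\<^sub>R W) has_derivative (\<lambda>t. t *\<^sub>R W)) (at 0)"
      by (auto intro!: derivative_eq_intros)
    moreover have "((\<lambda>z. F z i) has_derivative (\<lambda>h. DF x i \<bullet> h)) (at (x + 0 *\<^sub>R W))"
      using F_deriv by simp
    ultimately have "((\<lambda>t. F (x + t *\<^sub>R W) i) has_derivative (\<lambda>t. DF x i \<bullet> (t *\<^sub>R W))) (at 0)"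
      by (rule has_derivative_compose)
    then have "((\<lambda>t. F (x + t *\<^sub>R W) i) has_real_derivative (DF x i \<bullet> W)) (at 0)"
      by (simp add: has_field_derivative_def mult_commute_abs)
    then have "((\<lambda>t. D t i) \<longlongrightarrow> DF x i \<bullet> W) (at 0)"
      by (simp add: DERIV_def D_def)
    then show ?thesis by (rule filterlim_mono) (auto simp: at_within_le_at)
  qed
  \<comment> \<open>The comparison may use the optimizer at either end of the step, and which one
    may vary with \<open>t\<close>. The minimum covers both, and the two expressions have the same
    limit.\<close>
  have lim: "((\<lambda>t. min (\<Sum>i\<in>UNIV. c t i * D t i) (\<Sum>i\<in>UNIV. c 0 i * D t i)) \<longlongrightarrow>
      min (\<Sum>i\<in>UNIV. c 0 i * (DF x i \<bullet> W)) (\<Sum>i\<in>UNIV. c 0 i * (DF x i \<bullet> W))) (at_right 0)"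
    by (intro tendsto_intros c_lim D_lim)
  have lim': "((\<lambda>t. E * (\<Sum>i\<in>UNIV. \<bar>D t i\<bar>)) \<longlongrightarrow> E * (\<Sum>i\<in>UNIV. \<bar>DF x i \<bullet> W\<bar>)) (at_right 0)"
    by (intro tendsto_intros D_lim)
  have "\<forall>\<^sub>F t in at_right 0. \<forall>i. \<bar>F (x + t *\<^sub>R W) i\<bar> < B"
    using bound by (intro eventually_all_finite order_tendstoD(2)[OF tendsto_rabs[OF F_path]])
  then have "\<forall>\<^sub>F t in at_right 0. 0 < t \<and> (\<forall>i. \<bar>F (x + t *\<^sub>R W) i\<bar> < B)"
    using eventually_at_right_less[of 0] by (rule eventually_elim2) auto
  then have "\<forall>\<^sub>F t in at_right 0. min (\<Sum>i\<in>UNIV. c t i * D t i) (\<Sum>i\<in>UNIV. c 0 i * D t i)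
      \<le> E * (\<Sum>i\<in>UNIV. \<bar>D t i\<bar>)"
  proof eventually_elim
    case (elim t)
    then have t: "0 < t" and bt: "\<And>i. \<bar>F (x + t *\<^sub>R W) i\<bar> \<le> B" by (auto simp: less_imp_le)
    obtain q y where y: "y = x + t *\<^sub>R W \<or> y = x"
      and q: "emp_mean q (F (x + t *\<^sub>R W)) \<le> emp_mean q (F x)"
      and err: "\<And>i. \<bar>q $ i - p $ i * (1 - \<delta> / \<kappa> * (F y i - emp_mean p (F y)))\<bar> \<le> E"
      using solution_comparison[OF sol assms(2) ex less_imp_le[OF bound] bt] by blast
    obtain s where s: "s = t \<or> s = 0" and err_s: "\<And>i. \<bar>q $ i - c s i\<bar> \<le> E"
    proof (cases "y = x")
      case True
      then show ?thesis using that[of 0] err by (simp add: c_def)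
    next
      case False
      then show ?thesis using that[of t] y err by (simp add: c_def)
    qed
    have "(\<Sum>i\<in>UNIV. q $ i * D t i) = (emp_mean q (F (x + t *\<^sub>R W)) - emp_mean q (F x)) / t"
      by (simp add: D_def emp_mean_def sum_divide_distrib diff_divide_distrib right_diff_distrib sum_subtractf)
    then have "(\<Sum>i\<in>UNIV. q $ i * D t i) \<le> 0" using q t by (simp add: divide_nonpos_pos)
    then have "(\<Sum>i\<in>UNIV. c s i * D t i) \<le> (\<Sum>i\<in>UNIV. c s i * D t i) - (\<Sum>i\<in>UNIV. q $ i * D t i)" by simp
    also have "\<dots> = (\<Sum>i\<in>UNIV. (c s i - q $ i) * D t i)" by (simp add: left_diff_distrib sum_subtractf)
    also have "\<dots> \<le> (\<Sum>i\<in>UNIV. E * \<bar>D t i\<bar>)"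
    proof (rule sum_mono)
      fix i
      have "(c s i - q $ i) * D t i \<le> \<bar>c s i - q $ i\<bar> * \<bar>D t i\<bar>" by (metis abs_ge_self abs_mult)
      also have "\<dots> \<le> E * \<bar>D t i\<bar>" using err_s[of i] by (intro mult_right_mono) auto
      finally show "(c s i - q $ i) * D t i \<le> E * \<bar>D t i\<bar>" .
    qed
    finally have "(\<Sum>i\<in>UNIV. c s i * D t i) \<le> E * (\<Sum>i\<in>UNIV. \<bar>D t i\<bar>)" by (simp add: sum_distrib_left)
    then show ?case using s by (auto simp: min_le_iff_disj)
  qed
  then have "min (\<Sum>i\<in>UNIV. c 0 i * (DF x i \<bullet> W)) (\<Sum>i\<in>UNIV. c 0 i * (DF x i \<bullet> W)) \<le> E * (\<Sum>i\<in>UNIV. \<bar>DF x i \<bullet> W\<bar>)"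
    by (intro tendsto_le[OF _ lim' lim]) auto
  moreover have "(\<Sum>i\<in>UNIV. c 0 i * (DF x i \<bullet> W)) = W \<bullet> W"
    by (subst (2) W) (simp add: inner_sum_left)
  ultimately have "norm W * norm W \<le> E * (\<Sum>i\<in>UNIV. \<bar>DF x i \<bullet> W\<bar>)"
    by (simp add: power2_norm_eq_inner[symmetric] power2_eq_square)
  also have "\<dots> \<le> E * (\<Sum>i\<in>UNIV. norm (DF x i) * norm W)"
  proof -
    obtain q y where "\<And>i. \<bar>q $ i - p $ i * (1 - \<delta> / \<kappa> * (F y i - emp_mean p (F y)))\<bar> \<le> E"
      using solution_comparison[OF sol assms(2) ex less_imp_le[OF bound] less_imp_le[OF bound]] by blast
    then have "0 \<le> E" by (meson abs_ge_zero order_trans)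
    then show ?thesis by (intro mult_left_mono sum_mono Cauchy_Schwarz_ineq2)
  qed
  also have "\<dots> = (E * (\<Sum>i\<in>UNIV. norm (DF x i))) * norm W"
    by (simp add: sum_distrib_right mult.assoc)
  finally have *: "norm W * norm W \<le> (E * (\<Sum>i\<in>UNIV. norm (DF x i))) * norm W" .
  show ?thesis
  proof (cases "W = 0")
    \<comment> \<open>No division by \<open>norm W\<close> here: the claim reduces to
      \<open>0 \<le> E\<close>, which any instance of the comparison supplies.\<close>
    case True
    obtain q y where "\<And>i. \<bar>q $ i - p $ i * (1 - \<delta> / \<kappa> * (F y i - emp_mean p (F y)))\<bar> \<le> E"
      using solution_comparison[OF sol assms(2) ex less_imp_le[OF bound] less_imp_le[OF bound]] by blast
    then have "0 \<le> E" by (meson abs_ge_zero order_trans)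
    then have "norm W \<le> E * (\<Sum>i\<in>UNIV. norm (DF x i))" using True by (simp add: sum_nonneg)
    then show ?thesis by (simp add: W_def)
  next
    case False
    then have "norm W \<le> E * (\<Sum>i\<in>UNIV. norm (DF x i))" using * by simp
    then show ?thesis by (simp add: W_def)
  qed
qed

end

section \<open>Convergence of solutions to the SAA solution\<close>

context scenario_problem
begin

text \<open>The mean attains its maximum over the compact sphere at some \<open>w\<close>. Were it
  equal to the value at \<open>x0\<close>, strict concavity would put the midpoint of
  \<open>w\<close> and \<open>x0\<close> above the global maximum.\<close>

lemma sphere_gap:
  assumes max: "\<And>z. emp_mean p (F z) \<le> emp_mean p (F x0)" and "0 < r"
  obtains c where "0 < c" "\<And>z. dist x0 z = r \<Longrightarrow> emp_mean p (F z) \<le> emp_mean p (F x0) - c"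
proof -
  have "continuous_on (sphere x0 r) (\<lambda>z. emp_mean p (F z))"
    unfolding emp_mean_def
    by (intro continuous_intros continuous_at_imp_continuous_on ballI continuous_F)
  moreover have "sphere x0 r \<noteq> {}" using assms(2) by simp
  ultimately obtain w where w: "w \<in> sphere x0 r" "\<And>z. z \<in> sphere x0 r \<Longrightarrow> emp_mean p (F z) \<le> emp_mean p (F w)"
    using continuous_attains_sup[of "sphere x0 r"] by (metis compact_sphere)
  have "w \<noteq> x0" using w(1) assms(2) by auto
  then have "1/2 * emp_mean p (F w) + 1/2 * emp_mean p (F x0)
      < emp_mean p (F ((1/2) *\<^sub>R w + (1/2) *\<^sub>R x0))"
    by (intro emp_mean_strictly_concave) auto
  also have "\<dots> \<le> emp_mean p (F x0)" by (rule max)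
  finally have "emp_mean p (F w) < emp_mean p (F x0)" by simp
  then show ?thesis
    using that[of "emp_mean p (F x0) - emp_mean p (F w)"] w(2) by simp
qed

lemma F_bounded_cball:
  obtains B where "0 \<le> B" "\<And>z i. dist x0 z \<le> r \<Longrightarrow> \<bar>F z i\<bar> \<le> B"
proof -
  have "\<exists>B. \<forall>z\<in>cball x0 r. \<bar>F z i\<bar> \<le> B" for i
  proof -
    have "compact ((\<lambda>z. F z i) ` cball x0 r)"
      by (intro compact_continuous_image continuous_at_imp_continuous_on ballI continuous_F) auto
    then show ?thesis using compact_imp_bounded bounded_iff by (metis image_eqI real_norm_def)
  qed
  then obtain B where B: "\<And>i z. z \<in> cball x0 r \<Longrightarrow> \<bar>F z i\<bar> \<le> B i" by metis
  have "\<bar>F z i\<bar> \<le> (\<Sum>i\<in>UNIV. \<bar>B i\<bar>)" if "dist x0 z \<le> r" for z i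
  proof -
    have "\<bar>F z i\<bar> \<le> \<bar>B i\<bar>" using B[of z i] that by simp
    also have "\<dots> \<le> (\<Sum>i\<in>UNIV. \<bar>B i\<bar>)" by (rule member_le_sum) auto
    finally show ?thesis .
  qed
  then show ?thesis using that[of "\<Sum>i\<in>UNIV. \<bar>B i\<bar>"] by (simp add: sum_nonneg)
qed

lemma emp_mean_near:
  assumes q: "\<And>i. \<bar>q $ i / p $ i - 1\<bar> \<le> \<rho>" and v: "\<And>i. \<bar>v i\<bar> \<le> B"
  shows "\<bar>emp_mean q v - emp_mean p v\<bar> \<le> \<rho> * B"
proof -
  have "emp_mean q v - emp_mean p v = emp_mean p (\<lambda>i. (q $ i / p $ i - 1) * v i)"
    unfolding emp_mean_def sum_subtractf[symmetric]
    by (rule sum.cong) (use p_pos in \<open>auto simp: field_simps less_imp_neq[symmetric]\<close>)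
  also have "norm \<dots> \<le> \<rho> * B"
  proof (rule norm_emp_mean_le[OF p_prob])
    fix i show "norm ((q $ i / p $ i - 1) * v i) \<le> \<rho> * B"
      unfolding real_norm_def abs_mult using q[of i] v[of i]
      by (intro mult_mono) (auto intro: order_trans[OF abs_ge_zero])
  qed
  finally show ?thesis by simp
qed

text \<open>By concavity, the gap on the sphere of radius \<open>r\<close> propagates outwards, uniformly over all
  \<open>q\<close> close to \<open>p\<close>.\<close>
lemma outer_gap:
  assumes max: "\<And>z. emp_mean p (F z) \<le> emp_mean p (F x0)" and "0 < r"
  obtains c \<rho> where "0 < c" "0 < \<rho>"
    "\<And>q. q \<in> prob_vectors \<Longrightarrow> (\<And>i. \<bar>q $ i / p $ i - 1\<bar> < \<rho>) \<Longrightarrow>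
       emp_mean p (F x0) - c < emp_mean q (F x0)"
    "\<And>q z. q \<in> prob_vectors \<Longrightarrow> (\<And>i. \<bar>q $ i / p $ i - 1\<bar> < \<rho>) \<Longrightarrow> r \<le> dist x0 z \<Longrightarrow>
       emp_mean q (F z) \<le> emp_mean p (F x0) - c"
proof -
  obtain c where c: "0 < c" "\<And>z. dist x0 z = r \<Longrightarrow> emp_mean p (F z) \<le> emp_mean p (F x0) - c"
    using sphere_gap[OF max assms(2)] by blast
  obtain B where B: "0 \<le> B" "\<And>z i. dist x0 z \<le> r \<Longrightarrow> \<bar>F z i\<bar> \<le> B"
    using F_bounded_cball by blast
  \<comment> \<open>Passing from \<open>p\<close> to \<open>q\<close> then changes means on the ball
    by at most \<open>c/4\<close>: a gap of \<open>3/4 c\<close> remains on the sphere, while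
    \<open>x0\<close> loses less than \<open>c/2\<close>.\<close>
  define \<rho> where "\<rho> = c / (4 * (B + 1))"
  have \<rho>: "0 < \<rho>" using B(1) c(1) by (simp add: \<rho>_def)
  have \<rho>B: "\<rho> * B \<le> c / 4"
  proof -
    have "\<rho> * B \<le> \<rho> * (B + 1)" using \<rho> by simp
    also have "\<dots> = c / 4" using B(1) by (simp add: \<rho>_def field_simps)
    finally show ?thesis .
  qed
  have near: "\<bar>emp_mean q (F z) - emp_mean p (F z)\<bar> \<le> c / 4"
    if "\<And>i. \<bar>q $ i / p $ i - 1\<bar> < \<rho>" "dist x0 z \<le> r" for q z
    using emp_mean_near[of q \<rho> "F z" B] that B(2) \<rho>B by (smt (verit, best))
  have centre: "emp_mean p (F x0) - c/2 < emp_mean q (F x0)"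
    if "\<And>i. \<bar>q $ i / p $ i - 1\<bar> < \<rho>" for q
  proof -
    have "\<bar>emp_mean q (F x0) - emp_mean p (F x0)\<bar> \<le> c / 4" using near[OF that] assms(2) by simp
    then show ?thesis using c(1) by linarith
  qed
  have "emp_mean q (F z) \<le> emp_mean p (F x0) - c/2"
    if q: "q \<in> prob_vectors" "\<And>i. \<bar>q $ i / p $ i - 1\<bar> < \<rho>" and z: "r \<le> dist x0 z" for q z
  proof (rule ccontr)
    assume neg: "\<not> ?thesis"
    \<comment> \<open>The segment from \<open>x0\<close> to \<open>z\<close> crosses the sphere at
      \<open>w\<close>. Under \<open>q\<close> both ends exceed the maximum minus
      \<open>c/2\<close>, so by concavity \<open>w\<close> is at least that high, although the gap
      puts it at most at the maximum minus \<open>3/4 c\<close>.\<close>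
    define t where "t = r / dist x0 z"
    have "0 < dist x0 z" using z assms(2) by linarith
    then have t: "0 < t" "t \<le> 1" using z assms(2) by (simp_all add: t_def)
    define w where "w = (1 - t) *\<^sub>R x0 + t *\<^sub>R z"
    have "dist x0 w = r"
    proof -
      have "x0 - w = t *\<^sub>R (x0 - z)" by (simp add: w_def algebra_simps)
      then have "dist x0 w = t * dist x0 z" using t by (simp add: dist_norm)
      then show ?thesis using z assms(2) by (auto simp: t_def)
    qed
    then have "\<bar>emp_mean q (F w) - emp_mean p (F w)\<bar> \<le> c / 4" "emp_mean p (F w) \<le> emp_mean p (F x0) - c"
      using near[OF q(2), of w] c(2)[of w] by auto
    then have w: "emp_mean q (F w) \<le> emp_mean p (F x0) - 3/4 * c" by linarith
    show False
    proof (cases "t = 1")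
      case True
      then show False using neg w c(1) by (simp add: w_def)
    next
      case False
      then have "(1 - t) * emp_mean q (F x0) + t * emp_mean q (F z) \<le> emp_mean q (F w)"
        unfolding w_def using t by (intro emp_mean_concave q) auto
      moreover have "(1 - t) * (emp_mean p (F x0) - c/2) \<le> (1 - t) * emp_mean q (F x0)"
        using centre[OF q(2)] t by (intro mult_left_mono) auto
      moreover have "t * (emp_mean p (F x0) - c/2) \<le> t * emp_mean q (F z)"
        using neg t by (intro mult_left_mono) auto
      moreover have "(1 - t) * (emp_mean p (F x0) - c/2) + t * (emp_mean p (F x0) - c/2) = emp_mean p (F x0) - c/2"
        by (simp flip: distrib_right)
      ultimately have "emp_mean p (F x0) - c/2 \<le> emp_mean q (F w)" by linarith
      then show False using w c(1) by simp
    qed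
  qed
  then show ?thesis using that[of "c/2" \<rho>] centre c(1) \<rho> by simp
qed

text \<open>A far decision is bounded above by testing \<open>q = p\<close>. At \<open>x0\<close>
  the inner minimizer has ratios within \<rho> of 1, so the robust value there exceeds the maximum
  minus \<open>c\<close>.\<close>

lemma robust_solution_near:
  assumes max: "\<And>z. emp_mean p (F z) \<le> emp_mean p (F x0)" and "0 < r"
  shows "\<forall>\<^sub>F \<delta> in at_right 0. \<forall>z. solves \<phi> p F \<delta> z \<longrightarrow> dist x0 z < r"
proof -
  obtain c \<rho> where c: "0 < c" "0 < \<rho>"
    and centre: "\<And>q. q \<in> prob_vectors \<Longrightarrow> (\<And>i. \<bar>q $ i / p $ i - 1\<bar> < \<rho>) \<Longrightarrow>
       emp_mean p (F x0) - c < emp_mean q (F x0)"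
    and outer: "\<And>q z. q \<in> prob_vectors \<Longrightarrow> (\<And>i. \<bar>q $ i / p $ i - 1\<bar> < \<rho>) \<Longrightarrow> r \<le> dist x0 z \<Longrightarrow>
       emp_mean q (F z) \<le> emp_mean p (F x0) - c"
    using outer_gap[OF max assms(2)] by metis
  define B where "B = (\<Sum>i\<in>UNIV. \<bar>F x0 i\<bar>)"
  have B: "\<bar>F x0 i\<bar> \<le> B" for i unfolding B_def by (rule member_le_sum) auto
  have "0 < \<rho> / 2" using c by simp
  obtain \<epsilon>0 where \<epsilon>0: "0 < \<epsilon>0"
    "\<And>\<epsilon> v q i. 0 < \<epsilon> \<Longrightarrow> \<epsilon> < \<epsilon>0 \<Longrightarrow> (\<And>i. \<bar>v i\<bar> \<le> B) \<Longrightarrow> q \<in> prob_vectors \<Longrightarrow>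
       \<rho> \<le> \<bar>q $ i / p $ i - 1\<bar> \<Longrightarrow> ereal (emp_mean p v) < penalized \<phi> p v \<epsilon> q"
    using penalized_large_away[OF c(2)] by metis
  have ev: "\<forall>\<^sub>F \<delta> in at_right 0. 0 < \<delta> \<and> inner_expansion B \<delta> (1 * \<delta>) \<and> \<delta> < \<epsilon>0"
    using inner_expansion_little_o[of 1 B] eventually_at_right_less[of 0] eventually_at_right_real[OF \<epsilon>0(1)]
    by (auto elim: eventually_elim2 intro: eventually_conj)
  then show ?thesis
  proof eventually_elim
    case (elim \<delta>)
    then have \<delta>: "0 < \<delta>" "\<delta> < \<epsilon>0" and ex: "inner_expansion B \<delta> (1 * \<delta>)" by auto
    obtain q where q: "inner_min \<phi> p (F x0) \<delta> q"
      using inner_expansionD(1)[OF ex, of "F x0"] B by blast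
    then have qp: "q \<in> prob_vectors" by (simp add: inner_min_def)
    have "\<bar>q $ i / p $ i - 1\<bar> < \<rho>" for i
      by (rule inner_min_near[OF q]) (use \<epsilon>0(2) \<delta> B qp in blast)
    then have "ereal (emp_mean p (F x0) - c) < ereal (emp_mean q (F x0))" using centre[OF qp] by simp
    also have "\<dots> \<le> penalized \<phi> p (F x0) \<delta> q" using \<delta> by (rule_tac penalized_ge)
    also have "\<dots> = objective \<phi> p \<delta> (F x0)" using objective_eq_min[OF \<delta>(1) q] by simp
    finally have x0: "ereal (emp_mean p (F x0) - c) < objective \<phi> p \<delta> (F x0)" .
    show ?case
    proof (intro allI impI)
      fix z assume z: "solves \<phi> p F \<delta> z"
      show "dist x0 z < r"
      proof (rule ccontr)
        assume "\<not> dist x0 z < r"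
        moreover have "\<And>i. \<bar>p $ i / p $ i - 1\<bar> < \<rho>" using p_pos c(2) by (simp add: less_imp_neq[symmetric])
        ultimately have "emp_mean p (F z) \<le> emp_mean p (F x0) - c" using outer[OF p_prob] by simp
        then have "objective \<phi> p \<delta> (F z) \<le> ereal (emp_mean p (F x0) - c)"
          using objective_le[OF \<delta>(1) p_prob, of "F z"] penalized_self[of "F z" \<delta>] by (metis ereal_less_eq(3) order_trans)
        also note x0
        also have "objective \<phi> p \<delta> (F x0) \<le> objective \<phi> p \<delta> (F z)" using z by (simp add: solves_def)
        finally show False by simp
      qed
    qed
  qed
qed

text \<open>The optimistic objective need not be concave.  A finite maximum \<open>m\<close> at a single parameter
  \<open>- \<delta>1\<close> bounds the rewards under every \<open>q\<close> by \<open>m\<close> plus the penalty, which rules out all \<open>q\<close>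
  away from \<open>p\<close> once the penalty weight is large.\<close>
lemma optimistic_solution_near:
  assumes max: "\<And>z. emp_mean p (F z) \<le> emp_mean p (F x0)" and "0 < r"
    and "0 < \<delta>1" and sol: "solves \<phi> p F (- \<delta>1) x1"
  shows "\<forall>\<^sub>F \<delta> in at_left 0. \<forall>z. solves \<phi> p F \<delta> z \<longrightarrow> dist x0 z < r"
proof -
  obtain c \<rho> where c: "0 < c" "0 < \<rho>"
    and outer: "\<And>q z. q \<in> prob_vectors \<Longrightarrow> (\<And>i. \<bar>q $ i / p $ i - 1\<bar> < \<rho>) \<Longrightarrow> r \<le> dist x0 z \<Longrightarrow>
       emp_mean q (F z) \<le> emp_mean p (F x0) - c"
    using outer_gap[OF max assms(2)] by metis
  obtain \<gamma> where \<gamma>: "0 < \<gamma>" "\<And>q i. \<rho> \<le> \<bar>q $ i / p $ i - 1\<bar> \<Longrightarrow> ereal \<gamma> \<le> phi_divergence \<phi> q p"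
    using phi_divergence_bounded_below[OF c(2)] by blast
  \<comment> \<open>At a negative parameter the penalty only lowers the value, so the optimistic
    objective at \<open>x1\<close> is at most its largest reward; optimality of \<open>x1\<close>
    extends this bound to every \<open>z\<close>.\<close>
  define m where "m = (\<Sum>i\<in>UNIV. \<bar>F x1 i\<bar>)"
  have m: "penalized \<phi> p (F z) (- \<delta>1) q \<le> ereal m" if q: "q \<in> prob_vectors" for q z
  proof -
    have "penalized \<phi> p (F z) (- \<delta>1) q \<le> objective \<phi> p (- \<delta>1) (F z)"
      using objective_ge q assms(3) by simp
    also have "\<dots> \<le> objective \<phi> p (- \<delta>1) (F x1)" using sol by (simp add: solves_def)
    also have "\<dots> \<le> ereal m"
    proof -
      have "penalized \<phi> p (F x1) (- \<delta>1) q' \<le> ereal m" if q': "q' \<in> prob_vectors" for q'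
      proof -
        have "F x1 i \<le> m" for i
          using member_le_sum[of i UNIV "\<lambda>i. \<bar>F x1 i\<bar>"] by (simp add: m_def)
        then have "emp_mean q' (F x1) \<le> m"
          using emp_mean_mono[OF q', of "F x1" "\<lambda>_. m"] q' by simp
        then show ?thesis
          using penalized_le[of "- \<delta>1" "F x1" q'] assms(3) by (simp add: order_trans)
      qed
      then show ?thesis using assms(3) by (simp add: objective_def SUP_least)
    qed
    finally show ?thesis .
  qed
  \<comment> \<open>For \<open>q\<close> with divergence \<open>h \<ge> \<gamma>\<close> the
    reference bound gives a mean of at most \<open>m + h / \<delta>1\<close>. Once
    \<open>- 1 / \<delta>\<close> exceeds \<open>T\<close>, the penalty weight beyond
    \<open>1 / \<delta>1\<close> costs at least
    \<open>\<bar>m\<bar> + \<bar>emp_mean p (F x0)\<bar> + c\<close>, which pushes the value below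
    the maximum minus \<open>c\<close>.\<close>
  define T where "T = 1/\<delta>1 + (\<bar>m\<bar> + \<bar>emp_mean p (F x0)\<bar> + c) / \<gamma>"
  have T: "0 < T" using assms(3) \<gamma>(1) c(1) by (auto simp: T_def intro!: add_pos_nonneg)
  have "dist x0 z < r" if \<delta>: "\<delta> < 0" "- (1 / T) < \<delta>" and z: "solves \<phi> p F \<delta> z" for \<delta> z
  proof (rule ccontr)
    assume far: "\<not> dist x0 z < r"
    have big: "T < - 1 / \<delta>"
    proof -
      have "- \<delta> * T < 1" using \<delta>(2) T by (simp add: field_simps)
      then show ?thesis using \<delta>(1) by (simp add: field_simps)
    qed
    have "penalized \<phi> p (F z) \<delta> q \<le> ereal (emp_mean p (F x0) - c)" if q: "q \<in> prob_vectors" for q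
    proof (cases "\<forall>i. \<bar>q $ i / p $ i - 1\<bar> < \<rho>")
      case True
      then have "emp_mean q (F z) \<le> emp_mean p (F x0) - c" using outer[OF q] far by simp
      then show ?thesis using penalized_le[OF \<delta>(1), of "F z" q] by (meson ereal_less_eq(3) order_trans)
    next
      case False
      then obtain i where "\<rho> \<le> \<bar>q $ i / p $ i - 1\<bar>" by (auto simp: not_less)
      then have \<gamma>q: "ereal \<gamma> \<le> phi_divergence \<phi> q p" by (rule \<gamma>(2))
      show ?thesis
      proof (cases "phi_divergence \<phi> q p")
        case (real h)
        have h: "\<gamma> \<le> h" using \<gamma>q real by simp
        have "emp_mean q (F z) - h / \<delta>1 \<le> m" using m[OF q, of z] real by (simp add: penalized_def)
        moreover have "\<bar>m\<bar> + \<bar>emp_mean p (F x0)\<bar> + c \<le> h * (- 1 / \<delta> - 1 / \<delta>1)"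
        proof -
          have "\<bar>m\<bar> + \<bar>emp_mean p (F x0)\<bar> + c = \<gamma> * (T - 1 / \<delta>1)" using \<gamma>(1) by (simp add: T_def)
          also have "\<dots> \<le> h * (- 1 / \<delta> - 1 / \<delta>1)"
            using h big \<gamma>(1) c(1) by (intro mult_mono) (auto simp: T_def)
          finally show ?thesis .
        qed
        moreover have "h * (- 1 / \<delta> - 1 / \<delta>1) = - (1 / \<delta> * h) - h / \<delta>1" by (simp add: algebra_simps)
        ultimately have "emp_mean q (F z) + 1 / \<delta> * h \<le> emp_mean p (F x0) - c" by linarith
        then show ?thesis using real by (simp add: penalized_def)
      qed (use \<delta>(1) \<gamma>q in \<open>auto simp: penalized_def\<close>)
    qed
    then have "objective \<phi> p \<delta> (F z) \<le> ereal (emp_mean p (F x0) - c)"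
      using \<delta>(1) by (simp add: objective_def SUP_least)
    also have "\<dots> < ereal (emp_mean p (F x0))" using c(1) by simp
    also have "\<dots> \<le> objective \<phi> p \<delta> (F x0)"
      using objective_ge[OF \<delta>(1) p_prob, of "F x0"] by (simp add: penalized_self)
    also have "\<dots> \<le> objective \<phi> p \<delta> (F z)" using z by (simp add: solves_def)
    finally show False by simp
  qed
  then show ?thesis
    unfolding eventually_at_left_field using T by (intro exI[of _ "- (1 / T)"]) auto
qed

theorem solution_tendsto:
  assumes "\<forall>\<^sub>F \<delta> in nhds 0. solves \<phi> p F \<delta> (x \<delta>)"
  shows "(x \<longlongrightarrow> x 0) (at 0)"
proof (rule tendstoI)
  fix r :: real assume r: "0 < r"
  have max: "\<And>z. emp_mean p (F z) \<le> emp_mean p (F (x 0))"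
    using eventually_nhds_x_imp_x[OF assms] by (simp add: solves_zero)
  have sol: "\<forall>\<^sub>F \<delta> in at 0. solves \<phi> p F \<delta> (x \<delta>)"
    using assms unfolding eventually_nhds_conv_at by blast
  obtain d where d: "0 < d" "\<And>\<delta>. dist \<delta> 0 < d \<Longrightarrow> solves \<phi> p F \<delta> (x \<delta>)"
    using assms unfolding eventually_nhds_metric by blast
  \<comment> \<open>Any fixed negative parameter inside the neighbourhood can serve as the reference
    for the optimistic side.\<close>
  have "solves \<phi> p F (- (d/2)) (x (- (d/2)))" using d by simp
  then have "\<forall>\<^sub>F \<delta> in at_left 0. \<forall>z. solves \<phi> p F \<delta> z \<longrightarrow> dist (x 0) z < r"
    using optimistic_solution_near[OF max r, of "d/2"] d(1) by simp
  then have "\<forall>\<^sub>F \<delta> in at 0. \<forall>z. solves \<phi> p F \<delta> z \<longrightarrow> dist (x 0) z < r"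
    using robust_solution_near[OF max r] by (simp add: eventually_at_split)
  with sol show "\<forall>\<^sub>F \<delta> in at 0. dist (x \<delta>) (x 0) < r"
    by eventually_elim (simp add: dist_commute)
qed

end

section \<open>Local expansions\<close>

text \<open>Differentiability with tolerance 1 gives the constant \<open>onorm D + 1\<close>. The
  estimate is centred at \<open>x\<close>, which is all that the covariance along the solution path
  requires.\<close>

lemma has_derivative_imp_lipschitz_at:
  assumes "(f has_derivative D) (at x)"
  obtains K where "0 \<le> K" "\<forall>\<^sub>F y in nhds x. norm (f y - f x) \<le> K * norm (y - x)"
proof -
  have bl: "bounded_linear D" using assms by (rule has_derivative_bounded_linear)
  obtain d where d: "0 < d" "\<And>y. norm (y - x) < d \<Longrightarrow> norm (f y - f x - D (y - x)) \<le> 1 * norm (y - x)"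
    using assms zero_less_one unfolding has_derivative_at_alt by blast
  have "norm (f y - f x) \<le> (onorm D + 1) * norm (y - x)" if "dist y x < d" for y
  proof -
    have "norm (f y - f x) \<le> norm (f y - f x - D (y - x)) + norm (D (y - x))"
      by (metis diff_add_cancel norm_triangle_ineq)
    also have "\<dots> \<le> norm (y - x) + onorm D * norm (y - x)"
      using d(2)[of y] that onorm[OF bl, of "y - x"] by (auto simp: dist_norm)
    finally show ?thesis by (simp add: algebra_simps)
  qed
  then have "\<forall>\<^sub>F y in nhds x. norm (f y - f x) \<le> (onorm D + 1) * norm (y - x)"
    using d(1) unfolding eventually_nhds_metric by blast
  moreover have "0 \<le> onorm D + 1" using onorm_pos_le[OF bl] by simp
  ultimately show ?thesis using that by blast
qed

text \<open>Mean value inequality for \<open>f - D a\<close> on the ball around \<open>a\<close>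
  that reaches \<open>x\<close>, where the derivative differs from \<open>D a\<close> by at most
  \<open>K * norm (x - a)\<close>. Derivatives are compared with the one at the centre only, so a
  derivative differentiable at \<open>a\<close> qualifies.\<close>

lemma taylor_remainder_quadratic:
  fixes f :: "'a::euclidean_space \<Rightarrow> 'b::real_normed_vector"
  assumes deriv: "\<And>x. (f has_derivative D x) (at x)" and "0 \<le> K"
    and lip: "\<forall>\<^sub>F x in nhds a. \<forall>h. norm (D x h - D a h) \<le> K * norm (x - a) * norm h"
  shows "\<forall>\<^sub>F x in nhds a. norm (f x - f a - D a (x - a)) \<le> K * norm (x - a)^2"
proof -
  obtain d where d: "0 < d" "\<And>x h. dist x a < d \<Longrightarrow> norm (D x h - D a h) \<le> K * norm (x - a) * norm h"
    using lip unfolding eventually_nhds_metric by blast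
  have "norm (f x - f a - D a (x - a)) \<le> K * norm (x - a)^2" if x: "dist x a < d" for x
  proof -
    define S where "S = cball a (norm (x - a))"
    have lin: "linear (D a)" using deriv has_derivative_linear by blast
    have "norm ((\<lambda>y. f y - D a y) x - (\<lambda>y. f y - D a y) a) \<le> (K * norm (x - a)) * norm (x - a)"
    proof (rule differentiable_bound[where S = S])
      show "convex S" by (simp add: S_def)
      fix y assume "y \<in> S"
      then have y: "norm (y - a) \<le> norm (x - a)" by (simp add: S_def dist_norm norm_minus_commute)
      have Da: "(D a has_derivative D a) (at y)"
        by (rule bounded_linear_imp_has_derivative[OF has_derivative_bounded_linear[OF deriv]])
      show "((\<lambda>y. f y - D a y) has_derivative (\<lambda>h. D y h - D a h)) (at y within S)"
        by (rule has_derivative_at_withinI[OF has_derivative_diff[OF deriv Da]])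
      show "onorm (\<lambda>h. D y h - D a h) \<le> K * norm (x - a)"
      proof (rule onorm_le)
        fix h
        have "norm (D y h - D a h) \<le> K * norm (y - a) * norm h"
          using d(2)[of y h] x y by (simp add: dist_norm)
        also have "\<dots> \<le> K * norm (x - a) * norm h"
          using y \<open>0 \<le> K\<close> by (intro mult_right_mono mult_left_mono) auto
        finally show "norm (D y h - D a h) \<le> K * norm (x - a) * norm h" .
      qed
    qed (auto simp: S_def dist_norm norm_minus_commute)
    moreover have "(f x - D a x) - (f a - D a a) = f x - f a - D a (x - a)"
      by (simp add: linear_diff[OF lin])
    ultimately show ?thesis by (simp only: power2_eq_square mult.assoc)
  qed
  then show ?thesis using d(1) unfolding eventually_nhds_metric by blast
qed

lemma emp_mean_has_derivative:
  assumes "\<And>i. ((\<lambda>x. g x i) has_derivative D i) F"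
  shows "((\<lambda>x. emp_mean p (g x)) has_derivative (\<lambda>h. emp_mean p (\<lambda>i. D i h))) F"
  unfolding emp_mean_def by (intro has_derivative_sum has_derivative_scaleR_right assms)

lemma emp_mean_inner: "emp_mean p (\<lambda>i. g i \<bullet> h) = emp_mean p g \<bullet> h"
  by (simp add: emp_mean_def inner_sum_left)

lemma emp_mean_matrix: "emp_mean p (\<lambda>i. (H i :: real^'m^'k) *v h) = emp_mean p H *v h"
proof -
  have "(\<Sum>i\<in>UNIV. p $ i *\<^sub>R (H i *v h)) = (\<Sum>i\<in>UNIV. (p $ i *\<^sub>R H i) *v h)"
    by (simp add: scaleR_matrix_vector_assoc)
  also have "\<dots> = (\<Sum>i\<in>UNIV. p $ i *\<^sub>R H i) *v h"
    by (induction rule: finite_induct[OF finite]) (auto simp: matrix_vector_mult_add_rdistrib)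
  finally show ?thesis by (simp add: emp_mean_def)
qed

text \<open>The norm of the type \<open>real^'m^'k\<close> is the Frobenius norm, so the bound is
  Cauchy-Schwarz in each row.\<close>

lemma norm_matrix_vector_le: "norm ((A :: real^'m^'k) *v h) \<le> norm A * norm h"
proof -
  have "norm (A *v h) = L2_set (\<lambda>i. A $ i \<bullet> h) UNIV"
    by (simp add: norm_vec_def matrix_vector_mul_component L2_set_def)
  also have "\<dots> \<le> L2_set (\<lambda>i. norm (A $ i) * norm h) UNIV"
    unfolding L2_set_def
    by (intro real_sqrt_le_mono sum_mono) (metis Cauchy_Schwarz_ineq2 abs_ge_zero power2_abs power_mono)
  also have "\<dots> = norm A * norm h"
    by (simp add: norm_vec_def L2_set_left_distrib)
  finally show ?thesis .
qed

lemma matrix_inv_inverse: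
  assumes "invertible A"
  shows "A ** matrix_inv A = mat 1" "matrix_inv A ** A = mat 1"
  using someI_ex[OF assms[unfolded invertible_def]] unfolding matrix_inv_def by blast+

lemma emp_var_eq:
  assumes "p \<in> prob_vectors"
  shows "emp_var p v = emp_mean p (\<lambda>i. (v i)\<^sup>2) - (emp_mean p v)\<^sup>2"
proof -
  have "emp_var p v = emp_mean p (\<lambda>i. (v i)\<^sup>2 - emp_mean p v * v i)"
    by (simp add: emp_var_def emp_cov_eq[OF assms] power2_eq_square algebra_simps)
  then show ?thesis by (simp add: emp_mean_diff emp_mean_mult power2_eq_square)
qed

context scenario_problem
begin

lemma emp_mean_deriv: "((\<lambda>z. emp_mean p (F z)) has_derivative (\<lambda>h. emp_mean p (DF x) \<bullet> h)) (at x)"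
  using emp_mean_has_derivative[where p = p, OF F_deriv] by (simp add: emp_mean_inner)

lemma emp_grad_deriv:
  "((\<lambda>z. emp_mean p (DF z)) has_derivative (\<lambda>h. emp_mean p (HF x) *v h)) (at x)"
  using emp_mean_has_derivative[where p = p, OF DF_deriv] by (simp add: emp_mean_matrix)

lemma emp_var_deriv:
  "((\<lambda>z. emp_var p (F z)) has_derivative (\<lambda>h. 2 * (emp_cov p (DF x) (F x) \<bullet> h))) (at x)"
proof -
  have "((\<lambda>z. (F z i)\<^sup>2) has_derivative (\<lambda>h. 2 * F x i * (DF x i \<bullet> h))) (at x)" for i
    by (auto intro!: derivative_eq_intros F_deriv)
  then have "((\<lambda>z. emp_mean p (\<lambda>i. (F z i)\<^sup>2)) has_derivative (\<lambda>h. emp_mean p (\<lambda>i. 2 * F x i * (DF x i \<bullet> h)))) (at x)"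
    by (rule emp_mean_has_derivative)
  moreover have "((\<lambda>z. (emp_mean p (F z))\<^sup>2) has_derivative
      (\<lambda>h. 2 * emp_mean p (F x) * (emp_mean p (DF x) \<bullet> h))) (at x)"
    by (auto intro!: derivative_eq_intros emp_mean_deriv)
  ultimately have "((\<lambda>z. emp_var p (F z)) has_derivative (\<lambda>h. emp_mean p (\<lambda>i. 2 * F x i * (DF x i \<bullet> h))
      - 2 * emp_mean p (F x) * (emp_mean p (DF x) \<bullet> h))) (at x)"
    unfolding emp_var_eq[OF p_prob] by (rule has_derivative_diff)
  moreover have "emp_mean p (\<lambda>i. 2 * F x i * (DF x i \<bullet> h)) - 2 * emp_mean p (F x) * (emp_mean p (DF x) \<bullet> h)
      = 2 * (emp_cov p (DF x) (F x) \<bullet> h)" for h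
  proof -
    have "2 * (emp_cov p (DF x) (F x) \<bullet> h)
        = 2 * emp_mean p (\<lambda>i. F x i * (DF x i \<bullet> h) - emp_mean p (F x) * (DF x i \<bullet> h))"
      by (simp add: emp_cov_eq[OF p_prob] algebra_simps flip: emp_mean_inner)
    also have "\<dots> = 2 * emp_mean p (\<lambda>i. F x i * (DF x i \<bullet> h)) - 2 * (emp_mean p (F x) * (emp_mean p (DF x) \<bullet> h))"
      by (simp only: emp_mean_diff emp_mean_mult emp_mean_inner right_diff_distrib)
    also have "2 * emp_mean p (\<lambda>i. F x i * (DF x i \<bullet> h)) = emp_mean p (\<lambda>i. 2 * F x i * (DF x i \<bullet> h))"
      by (simp only: mult.assoc emp_mean_mult)
    finally show ?thesis by simp
  qed
  ultimately show ?thesis by simp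
qed

lemma emp_cov_deriv: "\<exists>D. ((\<lambda>z. emp_cov p (DF z) (F z)) has_derivative D) (at x)"
  unfolding emp_cov_eq[OF p_prob]
  by (rule exI, rule emp_mean_has_derivative, rule has_derivative_scaleR[OF has_derivative_diff[OF F_deriv emp_mean_deriv] DF_deriv])

lemma emp_cov_lipschitz_at:
  obtains K where "0 \<le> K"
    "\<forall>\<^sub>F z in nhds x. norm (emp_cov p (DF z) (F z) - emp_cov p (DF x) (F x)) \<le> K * norm (z - x)"
proof -
  obtain D where "((\<lambda>z. emp_cov p (DF z) (F z)) has_derivative D) (at x)"
    using emp_cov_deriv by blast
  from has_derivative_imp_lipschitz_at[OF this] show ?thesis using that by blast
qed

text \<open>Twice differentiable rewards already give a quadratic remainder: the gradient of the
  variance is twice the covariance, which is differentiable and hence Lipschitz at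
  \<open>x\<close>.\<close>

lemma emp_var_expansion:
  obtains K where "0 \<le> K"
    "\<forall>\<^sub>F z in nhds x. \<bar>emp_var p (F z) - emp_var p (F x) - 2 * (emp_cov p (DF x) (F x) \<bullet> (z - x))\<bar> \<le> K * norm (z - x)^2"
proof -
  obtain K where K: "0 \<le> K"
    "\<forall>\<^sub>F z in nhds x. norm (emp_cov p (DF z) (F z) - emp_cov p (DF x) (F x)) \<le> K * norm (z - x)"
    using emp_cov_lipschitz_at by blast
  have "\<forall>\<^sub>F z in nhds x. \<forall>h. norm (2 * (emp_cov p (DF z) (F z) \<bullet> h) - 2 * (emp_cov p (DF x) (F x) \<bullet> h))
      \<le> (2 * K) * norm (z - x) * norm h"
    using K(2)
  proof eventually_elim
    case (elim z)
    show ?case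
    proof
      fix h
      define d where "d = emp_cov p (DF z) (F z) - emp_cov p (DF x) (F x)"
      have "norm (2 * (emp_cov p (DF z) (F z) \<bullet> h) - 2 * (emp_cov p (DF x) (F x) \<bullet> h)) = 2 * \<bar>d \<bullet> h\<bar>"
        unfolding d_def inner_diff_left by (simp only: right_diff_distrib[symmetric] abs_mult real_norm_def abs_numeral)
      also have "\<dots> \<le> 2 * (norm d * norm h)" using Cauchy_Schwarz_ineq2[of d h] by simp
      also have "\<dots> \<le> 2 * ((K * norm (z - x)) * norm h)"
        using elim by (intro mult_left_mono mult_right_mono) (simp_all add: d_def)
      finally show "norm (2 * (emp_cov p (DF z) (F z) \<bullet> h) - 2 * (emp_cov p (DF x) (F x) \<bullet> h))
          \<le> (2 * K) * norm (z - x) * norm h"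
        by (simp only: mult.assoc)
    qed
  qed
  then have "\<forall>\<^sub>F z in nhds x. norm (emp_var p (F z) - emp_var p (F x) - 2 * (emp_cov p (DF x) (F x) \<bullet> (z - x)))
      \<le> (2 * K) * norm (z - x)^2"
    using K(1) by (intro taylor_remainder_quadratic[OF emp_var_deriv]) auto
  then show ?thesis using that[of "2 * K"] K(1) by simp
qed

text \<open>Here the Lipschitz Hessians enter: the Taylor remainder of the mean gradient, in general
  only \<open>o(norm (z - x))\<close>, becomes quadratic.\<close>

lemma emp_grad_quadratic:
  assumes "\<And>i. lipschitz_near (hessian (\<lambda>z. F z i)) x"
  obtains K where "0 \<le> K"
    "\<forall>\<^sub>F z in nhds x. norm (emp_mean p (DF z) - emp_mean p (DF x) - emp_mean p (HF x) *v (z - x)) \<le> K * norm (z - x)^2"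
proof -
  have "\<forall>i. \<exists>L. 0 \<le> L \<and> (\<forall>\<^sub>F z in nhds x. norm (HF z i - HF x i) \<le> L * norm (z - x))"
  proof
    fix i
    obtain e L where "0 < e" and L: "L-lipschitz_on (ball x e) (hessian (\<lambda>z. F z i))"
      using assms[of i] unfolding lipschitz_near_def by blast
    have "norm (HF z i - HF x i) \<le> L * norm (z - x)" if "dist z x < e" for z
      using lipschitz_onD[OF L, of z x] that \<open>0 < e\<close> by (simp add: dist_norm norm_minus_commute)
    then show "\<exists>L. 0 \<le> L \<and> (\<forall>\<^sub>F z in nhds x. norm (HF z i - HF x i) \<le> L * norm (z - x))"
      using \<open>0 < e\<close> lipschitz_on_nonneg[OF L] unfolding eventually_nhds_metric by blast
  qed
  from choice[OF this] obtain L where L: "\<And>i. 0 \<le> L i" "\<And>i. \<forall>\<^sub>F z in nhds x. norm (HF z i - HF x i) \<le> L i * norm (z - x)"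
    by blast
  define K where "K = (\<Sum>i\<in>UNIV. L i)"
  have K: "0 \<le> K" using L(1) by (simp add: K_def sum_nonneg)
  have "\<forall>\<^sub>F z in nhds x. \<forall>i. norm (HF z i - HF x i) \<le> L i * norm (z - x)"
    by (intro eventually_all_finite L(2))
  then have "\<forall>\<^sub>F z in nhds x. \<forall>h. norm (emp_mean p (HF z) *v h - emp_mean p (HF x) *v h) \<le> K * norm (z - x) * norm h"
  proof eventually_elim
    case (elim z)
    have "norm (HF z i - HF x i) \<le> K * norm (z - x)" for i
    proof -
      have "L i \<le> K" unfolding K_def using L(1) by (intro member_le_sum) auto
      then show ?thesis using elim by (meson mult_right_mono norm_ge_zero order_trans)
    qed
    then have *: "norm (emp_mean p (\<lambda>i. HF z i - HF x i)) \<le> K * norm (z - x)"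
      by (rule norm_emp_mean_le[OF p_prob])
    show ?case
    proof
      fix h
      have "emp_mean p (HF z) *v h - emp_mean p (HF x) *v h = emp_mean p (\<lambda>i. HF z i - HF x i) *v h"
        by (simp add: emp_mean_diff matrix_vector_mult_diff_rdistrib)
      then show "norm (emp_mean p (HF z) *v h - emp_mean p (HF x) *v h) \<le> K * norm (z - x) * norm h"
        using order_trans[OF norm_matrix_vector_le mult_right_mono[OF * norm_ge_zero], of h] by simp
    qed
  qed
  then show ?thesis
    using that[OF K] K taylor_remainder_quadratic[OF emp_grad_deriv, of K x] by blast
qed

section \<open>Negative definiteness at the maximizer\<close>

text \<open>Concavity puts the chord slope from \<open>a\<close> to \<open>b\<close> below every
  difference quotient at \<open>t\<close> in \<open>(0,1)\<close>, and hence below their limit at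
  0.\<close>

lemma emp_mean_first_order:
  "emp_mean p (F b) \<le> emp_mean p (F a) + emp_mean p (DF a) \<bullet> (b - a)"
proof -
  define c where "c = (\<lambda>t. a + t *\<^sub>R (b - a))"
  have "(c has_derivative (\<lambda>t. t *\<^sub>R (b - a))) (at 0)"
    unfolding c_def by (rule has_derivative_eq_rhs, (rule derivative_intros)+) simp
  moreover have "((\<lambda>z. emp_mean p (F z)) has_derivative (\<lambda>h. emp_mean p (DF a) \<bullet> h)) (at (c 0))"
    using emp_mean_deriv[of a] by (simp add: c_def)
  ultimately have "((\<lambda>t. emp_mean p (F (c t))) has_derivative (\<lambda>t. emp_mean p (DF a) \<bullet> (t *\<^sub>R (b - a)))) (at 0)"
    by (rule has_derivative_compose)
  then have "((\<lambda>t. emp_mean p (F (c t))) has_real_derivative emp_mean p (DF a) \<bullet> (b - a)) (at 0)"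
    by (simp add: has_field_derivative_def mult_commute_abs)
  then have "((\<lambda>t. (emp_mean p (F (c t)) - emp_mean p (F a)) / t) \<longlongrightarrow> emp_mean p (DF a) \<bullet> (b - a)) (at 0)"
    by (simp add: DERIV_def c_def)
  then have lim: "((\<lambda>t. (emp_mean p (F (c t)) - emp_mean p (F a)) / t) \<longlongrightarrow> emp_mean p (DF a) \<bullet> (b - a)) (at_right 0)"
    by (rule filterlim_mono) (auto simp: at_within_le_at)
  have "emp_mean p (F b) - emp_mean p (F a) \<le> (emp_mean p (F (c t)) - emp_mean p (F a)) / t"
    if t: "0 < t" "t < 1" for t
  proof -
    have "(1 - t) * emp_mean p (F a) + t * emp_mean p (F b) \<le> emp_mean p (F ((1 - t) *\<^sub>R a + t *\<^sub>R b))"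
      using t by (intro emp_mean_concave p_prob) auto
    also have "(1 - t) *\<^sub>R a + t *\<^sub>R b = c t" by (simp add: c_def algebra_simps)
    finally have "(emp_mean p (F b) - emp_mean p (F a)) * t \<le> emp_mean p (F (c t)) - emp_mean p (F a)"
      by (simp add: algebra_simps)
    then show ?thesis using t by (simp add: le_divide_eq)
  qed
  then have "\<forall>\<^sub>F t in at_right 0. emp_mean p (F b) - emp_mean p (F a) \<le> (emp_mean p (F (c t)) - emp_mean p (F a)) / t"
    unfolding eventually_at_right_field using zero_less_one by blast
  then have "emp_mean p (F b) - emp_mean p (F a) \<le> emp_mean p (DF a) \<bullet> (b - a)"
    by (intro tendsto_lowerbound[OF lim]) auto
  then show ?thesis by simp
qed

lemma emp_grad_zero:
  assumes "\<And>z. emp_mean p (F z) \<le> emp_mean p (F x)"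
  shows "emp_mean p (DF x) = 0"
proof -
  have "(\<lambda>h. emp_mean p (DF x) \<bullet> h) = (\<lambda>h. 0)"
    by (rule differential_zero_maxmin[OF _ open_UNIV emp_mean_deriv]) (use assms in auto)
  then have "emp_mean p (DF x) \<bullet> emp_mean p (DF x) = 0" by (rule fun_cong)
  then show ?thesis by simp
qed

text \<open>Cyclic monotonicity of the gradient at the points \<open>x\<close>, \<open>x + t h\<close> and \<open>x + t k\<close>; it replaces
  the symmetry of the Hessian.\<close>
lemma hessian_cyclic_monotone:
  assumes max: "\<And>z. emp_mean p (F z) \<le> emp_mean p (F x)"
  defines "A \<equiv> emp_mean p (HF x)"
  shows "(A *v h) \<bullet> h + (A *v k) \<bullet> k \<le> (A *v h) \<bullet> k"
proof -
  define G where "G = (\<lambda>z. emp_mean p (DF z))"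
  have lim: "((\<lambda>t. G (x + t *\<^sub>R u) \<bullet> w / t) \<longlongrightarrow> (A *v u) \<bullet> w) (at_right 0)" for u w
  proof -
    have "((\<lambda>t. x + t *\<^sub>R u) has_derivative (\<lambda>t. t *\<^sub>R u)) (at 0)"
      by (auto intro!: derivative_eq_intros)
    moreover have "(G has_derivative (\<lambda>h. A *v h)) (at (x + 0 *\<^sub>R u))"
      using emp_grad_deriv[of x] by (simp add: G_def A_def)
    ultimately have "((\<lambda>t. G (x + t *\<^sub>R u)) has_derivative (\<lambda>t. A *v (t *\<^sub>R u))) (at 0)"
      by (rule has_derivative_compose)
    then have "((\<lambda>t. G (x + t *\<^sub>R u) \<bullet> w) has_derivative (\<lambda>t. (A *v (t *\<^sub>R u)) \<bullet> w)) (at 0)"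
      by (rule has_derivative_inner_left)
    then have "((\<lambda>t. G (x + t *\<^sub>R u) \<bullet> w) has_real_derivative (A *v u) \<bullet> w) (at 0)"
      by (simp add: has_field_derivative_def matrix_vector_mult_scaleR mult_commute_abs)
    \<comment> \<open>The mean gradient vanishes at the maximizer, so dividing \<open>G\<close> by
      \<open>t\<close> is already a difference quotient.\<close>
    then have "((\<lambda>t. G (x + t *\<^sub>R u) \<bullet> w / t) \<longlongrightarrow> (A *v u) \<bullet> w) (at 0)"
      using emp_grad_zero[OF max] by (simp add: DERIV_def G_def)
    then show ?thesis by (rule filterlim_mono) (auto simp: at_within_le_at)
  qed
  have "((\<lambda>t. G (x + t *\<^sub>R h) \<bullet> (k - h) / t - G (x + t *\<^sub>R k) \<bullet> k / t)
      \<longlongrightarrow> (A *v h) \<bullet> (k - h) - (A *v k) \<bullet> k) (at_right 0)"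
    by (intro tendsto_diff lim)
  moreover have "0 \<le> G (x + t *\<^sub>R h) \<bullet> (k - h) / t - G (x + t *\<^sub>R k) \<bullet> k / t"
    if t: "0 < t" for t
  proof -
    \<comment> \<open>Two supergradient inequalities, from \<open>x + t h\<close> to
      \<open>x + t k\<close> and from there to \<open>x\<close>, are closed into a cycle by the
      maximality of \<open>x\<close>.\<close>
    have "emp_mean p (F (x + t *\<^sub>R k)) \<le> emp_mean p (F (x + t *\<^sub>R h)) + t * (G (x + t *\<^sub>R h) \<bullet> (k - h))"
      using emp_mean_first_order[of "x + t *\<^sub>R k" "x + t *\<^sub>R h"]
      by (simp add: G_def algebra_simps inner_diff_right)
    moreover have "emp_mean p (F x) \<le> emp_mean p (F (x + t *\<^sub>R k)) - t * (G (x + t *\<^sub>R k) \<bullet> k)"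
      using emp_mean_first_order[of x "x + t *\<^sub>R k"] by (simp add: G_def)
    ultimately have "0 \<le> t * (G (x + t *\<^sub>R h) \<bullet> (k - h)) - t * (G (x + t *\<^sub>R k) \<bullet> k)"
      using max[of "x + t *\<^sub>R h"] by linarith
    then have "0 \<le> t * (G (x + t *\<^sub>R h) \<bullet> (k - h) - G (x + t *\<^sub>R k) \<bullet> k)"
      by (simp add: right_diff_distrib)
    then have "0 \<le> G (x + t *\<^sub>R h) \<bullet> (k - h) - G (x + t *\<^sub>R k) \<bullet> k"
      using t by (simp add: zero_le_mult_iff)
    then show ?thesis using t unfolding diff_divide_distrib[symmetric] by simp
  qed
  then have "\<forall>\<^sub>F t in at_right 0. 0 \<le> G (x + t *\<^sub>R h) \<bullet> (k - h) / t - G (x + t *\<^sub>R k) \<bullet> k / t"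
    by (intro eventually_mono[OF eventually_at_right_less[of 0]]) auto
  ultimately have "0 \<le> (A *v h) \<bullet> (k - h) - (A *v k) \<bullet> k"
    by (intro tendsto_lowerbound[where F = "at_right (0::real)"]) auto
  then show ?thesis by (simp add: inner_diff_right)
qed

text \<open>With \<open>k = 0\<close> cyclic monotonicity gives semidefiniteness. If the form
  vanished at \<open>w\<close>, where \<open>A w = \<beta>\<close>, then \<open>h = - s w\<close>
  and \<open>k = \<beta>\<close> would give \<open>(A \<beta>) \<bullet> \<beta> \<le> - s (\<beta>
  \<bullet> \<beta>)\<close> for every \<open>s\<close>, which is absurd for large
  \<open>s\<close>.\<close>

lemma inverse_hessian_negative:
  assumes max: "\<And>z. emp_mean p (F z) \<le> emp_mean p (F x)"
    and inv: "invertible (emp_mean p (HF x))" and "\<beta> \<noteq> 0"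
  shows "\<beta> \<bullet> (matrix_inv (emp_mean p (HF x)) *v \<beta>) < 0"
proof -
  define A where "A = emp_mean p (HF x)"
  define w where "w = matrix_inv A *v \<beta>"
  have A: "A *v w = \<beta>"
    using matrix_inv_inverse(1)[OF inv] by (simp add: w_def A_def matrix_vector_mul_assoc)
  note cyclic = hessian_cyclic_monotone[OF max, folded A_def]
  have "(A *v w) \<bullet> w \<le> 0" using cyclic[of w 0] by simp
  moreover have "(A *v w) \<bullet> w \<noteq> 0"
  proof
    assume zero: "(A *v w) \<bullet> w = 0"
    have "(A *v (- s *\<^sub>R w)) \<bullet> (- s *\<^sub>R w) + (A *v \<beta>) \<bullet> \<beta> \<le> (A *v (- s *\<^sub>R w)) \<bullet> \<beta>"
      for s by (rule cyclic)
    then have bound: "(A *v \<beta>) \<bullet> \<beta> \<le> - (s * (\<beta> \<bullet> \<beta>))" for s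
      using zero A by (simp add: matrix_vector_mult_scaleR del: scaleR_minus_left)
    define s where "s = \<bar>(A *v \<beta>) \<bullet> \<beta>\<bar> + 1"
    have "(A *v \<beta>) \<bullet> \<beta> \<le> - ((s / (\<beta> \<bullet> \<beta>)) * (\<beta> \<bullet> \<beta>))" by (rule bound)
    also have "\<dots> = - s" using \<open>\<beta> \<noteq> 0\<close> by simp
    finally show False by (simp add: s_def abs_real_def split: if_splits)
  qed
  ultimately show ?thesis using A by (simp add: w_def A_def inner_commute)
qed

end

section \<open>Expansion of the sensitivity\<close>

lemma square_smallo_ident: "(\<lambda>\<delta>::real. \<delta>\<^sup>2) \<in> o[at 0](\<lambda>\<delta>. \<delta>)"
proof (rule landau_o.smallI)
  fix c :: real assume "0 < c"
  then have "\<forall>\<^sub>F \<delta> in at 0. \<bar>\<delta>\<bar> < c"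
    unfolding eventually_at by (auto intro!: exI[of _ c] simp: dist_real_def)
  then show "\<forall>\<^sub>F \<delta>::real in at 0. norm (\<delta>\<^sup>2) \<le> c * norm \<delta>"
    unfolding power2_eq_square real_norm_def abs_mult
    by eventually_elim (intro mult_right_mono, auto)
qed

lemma norm_add_diff_bigo:
  "(\<lambda>t. norm (a t + b t - c t)) \<in> O[F](\<lambda>t. norm (a t) + norm (b t) + norm (c t))"
proof (intro bigoI[of _ 1] always_eventually allI)
  fix t
  have "norm (a t + b t - c t) \<le> norm (a t) + norm (b t) + norm (c t)"
    using norm_triangle_ineq4[of "a t + b t" "c t"] norm_triangle_ineq[of "a t" "b t"] by linarith
  then show "norm (norm (a t + b t - c t)) \<le> 1 * norm (norm (a t) + norm (b t) + norm (c t))"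
    by simp
qed

section \<open>First-order defect along the solution path\<close>

context scenario_problem
begin

abbreviation stationarity_defect :: "real \<Rightarrow> real^'d \<Rightarrow> real^'d" where
  "stationarity_defect \<delta> x \<equiv> emp_mean p (DF x) - (\<delta> / \<kappa>) *\<^sub>R emp_cov p (DF x) (F x)"

text \<open>Since \<open>x \<delta>\<close> converges, rewards and gradients along it stay below
  fixed constants \<open>B\<close> and \<open>C\<close>. The constants are found before
  \<open>E\<close> is chosen, and the one-sided expansion at \<open>\<bar>\<delta>\<bar>\<close>
  serves both signs of \<delta>.\<close>

lemma stationarity_defect_bound:
  assumes sol: "\<forall>\<^sub>F \<delta> in nhds 0. solves \<phi> p F \<delta> (x \<delta>)"
  obtains B C where "0 < C"
    "\<And>E. (\<And>\<epsilon>. 0 < \<epsilon> \<Longrightarrow> 0 \<le> E \<epsilon>) \<Longrightarrow> \<forall>\<^sub>F \<epsilon> in at_right 0. inner_expansion B \<epsilon> (E \<epsilon>) \<Longrightarrow>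
       \<forall>\<^sub>F \<delta> in at 0. norm (stationarity_defect \<delta> (x \<delta>)) \<le> E \<bar>\<delta>\<bar> * C"
proof -
  have lim: "(x \<longlongrightarrow> x 0) (at 0)" by (rule solution_tendsto[OF sol])
  define B where "B = (\<Sum>i\<in>UNIV. \<bar>F (x 0) i\<bar>) + 1"
  define C where "C = (\<Sum>i\<in>UNIV. norm (DF (x 0) i)) + 1"
  have "\<bar>F (x 0) i\<bar> < B" for i
    using member_le_sum[of i UNIV "\<lambda>i. \<bar>F (x 0) i\<bar>"] by (simp add: B_def)
  then have ev_B: "\<forall>\<^sub>F \<delta> in at 0. \<forall>i. \<bar>F (x \<delta>) i\<bar> < B"
    by (intro eventually_all_finite order_tendstoD(2)[OF tendsto_rabs[OF isCont_tendsto_compose[OF continuous_F lim]]])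
  have "((\<lambda>\<delta>. \<Sum>i\<in>UNIV. norm (DF (x \<delta>) i)) \<longlongrightarrow> (\<Sum>i\<in>UNIV. norm (DF (x 0) i))) (at 0)"
    by (intro tendsto_sum tendsto_norm isCont_tendsto_compose[OF has_derivative_continuous[OF DF_deriv] lim])
  then have ev_C: "\<forall>\<^sub>F \<delta> in at 0. (\<Sum>i\<in>UNIV. norm (DF (x \<delta>) i)) < C"
    by (rule order_tendstoD(2)) (simp add: C_def)
  have ev_sol: "\<forall>\<^sub>F \<delta> in at 0. solves \<phi> p F \<delta> (x \<delta>)"
    using sol unfolding eventually_nhds_conv_at by blast
  have ev_nz: "\<forall>\<^sub>F \<delta> in at 0. (\<delta>::real) \<noteq> 0" by (rule eventually_neq_at_within)
  have "\<forall>\<^sub>F \<delta> in at 0. norm (stationarity_defect \<delta> (x \<delta>)) \<le> E \<bar>\<delta>\<bar> * C"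
    if E: "\<And>\<epsilon>. 0 < \<epsilon> \<Longrightarrow> 0 \<le> E \<epsilon>" "\<forall>\<^sub>F \<epsilon> in at_right 0. inner_expansion B \<epsilon> (E \<epsilon>)" for E
  proof -
    obtain b where b: "0 < b" "\<And>\<epsilon>. 0 < \<epsilon> \<Longrightarrow> \<epsilon> < b \<Longrightarrow> inner_expansion B \<epsilon> (E \<epsilon>)"
      using E(2) unfolding eventually_at_right_field by blast
    have "\<forall>\<^sub>F \<delta> in at 0. \<bar>\<delta>\<bar> < b"
      unfolding eventually_at using b(1) by (auto intro!: exI[of _ b] simp: dist_real_def)
    with ev_B ev_C ev_sol ev_nz show ?thesis
    proof eventually_elim
      case (elim \<delta>)
      then have "norm (stationarity_defect \<delta> (x \<delta>)) \<le> E \<bar>\<delta>\<bar> * (\<Sum>i\<in>UNIV. norm (DF (x \<delta>) i))"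
        by (intro first_order_condition[where B = B] b(2)) auto
      also have "\<dots> \<le> E \<bar>\<delta>\<bar> * C" using elim E(1)[of "\<bar>\<delta>\<bar>"] by (intro mult_left_mono) auto
      finally show ?case .
    qed
  qed
  moreover have "0 < C" by (simp add: C_def sum_nonneg add_nonneg_pos)
  ultimately show ?thesis using that[of C B] by blast
qed

lemma stationarity_defect_smallo:
  assumes sol: "\<forall>\<^sub>F \<delta> in nhds 0. solves \<phi> p F \<delta> (x \<delta>)"
  shows "(\<lambda>\<delta>. norm (stationarity_defect \<delta> (x \<delta>))) \<in> o[at 0](\<lambda>\<delta>. \<delta>)"
proof (rule landau_o.smallI)
  fix c :: real assume c: "0 < c"
  obtain B C where C: "0 < C" and bound:
    "\<And>E. (\<And>\<epsilon>. 0 < \<epsilon> \<Longrightarrow> 0 \<le> E \<epsilon>) \<Longrightarrow> \<forall>\<^sub>F \<epsilon> in at_right 0. inner_expansion B \<epsilon> (E \<epsilon>) \<Longrightarrow>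
       \<forall>\<^sub>F \<delta> in at 0. norm (stationarity_defect \<delta> (x \<delta>)) \<le> E \<bar>\<delta>\<bar> * C"
    using stationarity_defect_bound[OF sol] by blast
  have "\<forall>\<^sub>F \<delta> in at 0. norm (stationarity_defect \<delta> (x \<delta>)) \<le> (c / C * \<bar>\<delta>\<bar>) * C"
    by (rule bound) (use c C inner_expansion_little_o[of "c / C"] in auto)
  then show "\<forall>\<^sub>F \<delta> in at 0. norm (norm (stationarity_defect \<delta> (x \<delta>))) \<le> c * norm \<delta>"
    by eventually_elim (use C in simp)
qed

lemma stationarity_defect_bigo:
  assumes sol: "\<forall>\<^sub>F \<delta> in nhds 0. solves \<phi> p F \<delta> (x \<delta>)" and lip: "lipschitz_near (deriv2 \<phi>) 1"
  shows "(\<lambda>\<delta>. norm (stationarity_defect \<delta> (x \<delta>))) \<in> O[at 0](\<lambda>\<delta>. \<delta>\<^sup>2)"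
proof -
  obtain B C where C: "0 < C" and bound:
    "\<And>E. (\<And>\<epsilon>. 0 < \<epsilon> \<Longrightarrow> 0 \<le> E \<epsilon>) \<Longrightarrow> \<forall>\<^sub>F \<epsilon> in at_right 0. inner_expansion B \<epsilon> (E \<epsilon>) \<Longrightarrow>
       \<forall>\<^sub>F \<delta> in at 0. norm (stationarity_defect \<delta> (x \<delta>)) \<le> E \<bar>\<delta>\<bar> * C"
    using stationarity_defect_bound[OF sol] by blast
  obtain C' where C': "0 \<le> C'" "\<forall>\<^sub>F \<epsilon> in at_right 0. inner_expansion B \<epsilon> (C' * \<epsilon>\<^sup>2)"
    using inner_expansion_quadratic[OF lip] by blast
  have "\<forall>\<^sub>F \<delta> in at 0. norm (stationarity_defect \<delta> (x \<delta>)) \<le> (C' * \<bar>\<delta>\<bar>\<^sup>2) * C"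
    by (rule bound) (use C' in auto)
  then show ?thesis
    by (intro bigoI[of _ "C' * C"]) (simp add: mult_ac)
qed

lemma gradient_remainder_smallo:
  assumes lim: "(x \<longlongrightarrow> x 0) (at 0)"
  shows "(\<lambda>\<delta>. norm (emp_mean p (DF (x \<delta>)) - emp_mean p (DF (x 0)) - emp_mean p (HF (x 0)) *v (x \<delta> - x 0)))
    \<in> o[at 0](\<lambda>\<delta>. norm (x \<delta> - x 0))"
proof (rule landau_o.smallI)
  fix c :: real assume "0 < c"
  then obtain d where d: "0 < d" "\<And>z. norm (z - x 0) < d \<Longrightarrow>
      norm (emp_mean p (DF z) - emp_mean p (DF (x 0)) - emp_mean p (HF (x 0)) *v (z - x 0)) \<le> c * norm (z - x 0)"
    using emp_grad_deriv[of "x 0"] unfolding has_derivative_at_alt by blast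
  have "\<forall>\<^sub>F \<delta> in at 0. dist (x \<delta>) (x 0) < d" using lim d(1) by (rule tendstoD)
  then show "\<forall>\<^sub>F \<delta> in at 0. norm (norm (emp_mean p (DF (x \<delta>)) - emp_mean p (DF (x 0)) -
      emp_mean p (HF (x 0)) *v (x \<delta> - x 0))) \<le> c * norm (norm (x \<delta> - x 0))"
    by eventually_elim (use d(2) in \<open>simp add: dist_norm\<close>)
qed

lemma gradient_remainder_bigo:
  assumes lim: "(x \<longlongrightarrow> x 0) (at 0)" and lip: "\<And>i. lipschitz_near (hessian (\<lambda>z. F z i)) (x 0)"
  shows "(\<lambda>\<delta>. norm (emp_mean p (DF (x \<delta>)) - emp_mean p (DF (x 0)) - emp_mean p (HF (x 0)) *v (x \<delta> - x 0)))
    \<in> O[at 0](\<lambda>\<delta>. (norm (x \<delta> - x 0))\<^sup>2)"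
proof -
  obtain K where "0 \<le> K" and K: "\<forall>\<^sub>F z in nhds (x 0).
      norm (emp_mean p (DF z) - emp_mean p (DF (x 0)) - emp_mean p (HF (x 0)) *v (z - x 0)) \<le> K * norm (z - x 0)^2"
    using emp_grad_quadratic[OF lip] by blast
  from eventually_compose_filterlim[OF K lim] show ?thesis by (intro bigoI[of _ K]) simp
qed

text \<open>Invertibility is a separate nondegeneracy condition: strict concavity permits a singular
  Hessian, as for the fourth power with a minus sign at 0.\<close>

context
  fixes x :: "real \<Rightarrow> real^'d"
  assumes sol: "\<forall>\<^sub>F \<delta> in nhds 0. solves \<phi> p F \<delta> (x \<delta>)"
    and inv: "invertible (emp_mean p (HF (x 0)))"
begin

abbreviation A :: "real^'d^'d" where "A \<equiv> emp_mean p (HF (x 0))"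
abbreviation \<beta> :: "real^'d" where "\<beta> \<equiv> emp_cov p (DF (x 0)) (F (x 0))"
abbreviation remainder :: "real \<Rightarrow> real^'d" where
  "remainder \<delta> \<equiv> emp_mean p (DF (x \<delta>)) - emp_mean p (DF (x 0)) - A *v (x \<delta> - x 0)"

lemma maximizer: "emp_mean p (F z) \<le> emp_mean p (F (x 0))"
  using eventually_nhds_x_imp_x[OF sol] by (simp add: solves_zero)

lemma lim: "(x \<longlongrightarrow> x 0) (at 0)"
  by (rule solution_tendsto[OF sol])

text \<open>The error in the linear equation for the displacement has three sources: imperfect
  stationarity, drift of the covariance, and the Taylor remainder of the mean gradient.\<close>

lemma linearized_defect:
  "A *v (x \<delta> - x 0) - (\<delta> / \<kappa>) *\<^sub>R \<beta> = stationarity_defect \<delta> (x \<delta>)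
     + (\<delta> / \<kappa>) *\<^sub>R (emp_cov p (DF (x \<delta>)) (F (x \<delta>)) - \<beta>) - remainder \<delta>"
  using emp_grad_zero[OF maximizer] by (simp add: scaleR_diff_right)

lemma norm_inverse_hessian_le: "norm (matrix_inv A *v y) \<le> norm (matrix_inv A) * norm y"
  by (rule norm_matrix_vector_le)

lemma inverse_hessian_cancel: "matrix_inv A *v (A *v h) = h"
  using matrix_inv_inverse(2)[OF inv] by (simp add: matrix_vector_mul_assoc)

text \<open>The Taylor remainder is only known relative to the displacement \<open>h\<close>, so it
  is absorbed: with tolerance \<open>1 / (2 * K)\<close>, where \<open>K\<close> exceeds the norm of
  the inverse Hessian, it contributes at most half of \<open>norm h\<close>. The other terms are of
  order \<delta>.\<close>

lemma solution_bigo: "(\<lambda>\<delta>. norm (x \<delta> - x 0)) \<in> O[at 0](\<lambda>\<delta>. \<delta>)"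
proof -
  define K where "K = norm (matrix_inv A) + 1"
  have K: "0 < K" by (simp add: K_def add_nonneg_pos)
  have "((\<lambda>\<delta>. emp_cov p (DF (x \<delta>)) (F (x \<delta>))) \<longlongrightarrow> \<beta>) (at 0)"
  proof -
    obtain D where "((\<lambda>z. emp_cov p (DF z) (F z)) has_derivative D) (at (x 0))"
      using emp_cov_deriv by blast
    from isCont_tendsto_compose[OF has_derivative_continuous[OF this] lim] show ?thesis .
  qed
  then have "\<forall>\<^sub>F \<delta> in at 0. dist (emp_cov p (DF (x \<delta>)) (F (x \<delta>))) \<beta> < 1" by (rule tendstoD) simp
  moreover have "\<forall>\<^sub>F \<delta> in at 0. norm (norm (stationarity_defect \<delta> (x \<delta>))) \<le> 1 * norm \<delta>"
    by (rule landau_o.smallD[OF stationarity_defect_smallo[OF sol]]) simp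
  moreover have "\<forall>\<^sub>F \<delta> in at 0. norm (norm (remainder \<delta>)) \<le> 1 / (2 * K) * norm (norm (x \<delta> - x 0))"
    by (rule landau_o.smallD[OF gradient_remainder_smallo[OF lim]]) (use K in simp)
  ultimately have "\<forall>\<^sub>F \<delta> in at 0. norm (norm (x \<delta> - x 0)) \<le> (2 * K * (norm \<beta> / \<kappa> + 1 + 1 / \<kappa>)) * norm \<delta>"
  proof eventually_elim
    case (elim \<delta>)
    define h where "h = x \<delta> - x 0"
    define c where "c = emp_cov p (DF (x \<delta>)) (F (x \<delta>)) - \<beta>"
    have "norm c \<le> 1" using elim(1) by (simp add: c_def dist_norm)
    then have "\<bar>\<delta> / \<kappa>\<bar> * norm c \<le> \<bar>\<delta> / \<kappa>\<bar> * 1" by (intro mult_left_mono) auto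
    then have c': "norm ((\<delta> / \<kappa>) *\<^sub>R c) \<le> \<bar>\<delta>\<bar> / \<kappa>" using kappa_pos by simp
    have b: "norm ((\<delta> / \<kappa>) *\<^sub>R \<beta>) \<le> \<bar>\<delta>\<bar> * (norm \<beta> / \<kappa>)" using kappa_pos by simp
    have d: "norm (stationarity_defect \<delta> (x \<delta>)) \<le> \<bar>\<delta>\<bar>" using elim(2) by (simp only: mult_1 real_norm_def abs_norm_cancel)
    have r: "norm (remainder \<delta>) \<le> 1 / (2 * K) * norm h" using elim(3) by (simp only: real_norm_def abs_norm_cancel h_def)
    define s where "s = stationarity_defect \<delta> (x \<delta>)"
    define \<rho> where "\<rho> = remainder \<delta>"
    have "A *v h - (\<delta> / \<kappa>) *\<^sub>R \<beta> = s + (\<delta> / \<kappa>) *\<^sub>R c - \<rho>"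
      unfolding h_def c_def s_def \<rho>_def by (rule linearized_defect)
    then have Ah: "A *v h = (\<delta> / \<kappa>) *\<^sub>R \<beta> + (s + (\<delta> / \<kappa>) *\<^sub>R c - \<rho>)"
      by (simp only: diff_eq_eq add.commute)
    have "norm (A *v h) \<le> norm ((\<delta> / \<kappa>) *\<^sub>R \<beta>) + (norm s + norm ((\<delta> / \<kappa>) *\<^sub>R c) + norm \<rho>)"
      unfolding Ah using norm_triangle_ineq[of "(\<delta> / \<kappa>) *\<^sub>R \<beta>" "s + (\<delta> / \<kappa>) *\<^sub>R c - \<rho>"]
        norm_triangle_ineq4[of "s + (\<delta> / \<kappa>) *\<^sub>R c" \<rho>] norm_triangle_ineq[of s "(\<delta> / \<kappa>) *\<^sub>R c"]
      by linarith
    also have "\<dots> \<le> \<bar>\<delta>\<bar> * (norm \<beta> / \<kappa>) + \<bar>\<delta>\<bar> + \<bar>\<delta>\<bar> / \<kappa> + 1 / (2 * K) * norm h"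
      using b c' d[folded s_def] r[folded \<rho>_def] by linarith
    finally have "K * norm (A *v h) \<le> K * (\<bar>\<delta>\<bar> * (norm \<beta> / \<kappa>) + \<bar>\<delta>\<bar> + \<bar>\<delta>\<bar> / \<kappa> + 1 / (2 * K) * norm h)"
      using K by (intro mult_left_mono) auto
    also have "\<dots> = K * (norm \<beta> / \<kappa> + 1 + 1 / \<kappa>) * \<bar>\<delta>\<bar> + norm h / 2"
      using K by (simp add: field_simps)
    finally have "K * norm (A *v h) \<le> K * (norm \<beta> / \<kappa> + 1 + 1 / \<kappa>) * \<bar>\<delta>\<bar> + norm h / 2" .
    moreover have "norm h \<le> K * norm (A *v h)"
      using norm_inverse_hessian_le[of "A *v h"] inverse_hessian_cancel[of h]
      by (simp add: K_def distrib_right add_increasing2)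
    ultimately have "norm h \<le> 2 * (K * (norm \<beta> / \<kappa> + 1 + 1 / \<kappa>) * \<bar>\<delta>\<bar>)" by linarith
    then show ?case by (simp add: h_def mult.assoc)
  qed
  then show ?thesis by (rule bigoI)
qed

lemma solution_square_bigo: "(\<lambda>\<delta>. (norm (x \<delta> - x 0))\<^sup>2) \<in> O[at 0](\<lambda>\<delta>. \<delta>\<^sup>2)"
  using landau_o.big.mult[OF solution_bigo solution_bigo] by (simp add: power2_eq_square)

lemma covariance_term_bigo:
  "(\<lambda>\<delta>. norm ((\<delta> / \<kappa>) *\<^sub>R (emp_cov p (DF (x \<delta>)) (F (x \<delta>)) - \<beta>))) \<in> O[at 0](\<lambda>\<delta>. \<delta>\<^sup>2)"
proof -
  obtain K where K: "0 \<le> K"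
    "\<forall>\<^sub>F z in nhds (x 0). norm (emp_cov p (DF z) (F z) - \<beta>) \<le> K * norm (z - x 0)"
    using emp_cov_lipschitz_at by blast
  have "(\<lambda>\<delta>. norm (emp_cov p (DF (x \<delta>)) (F (x \<delta>)) - \<beta>)) \<in> O[at 0](\<lambda>\<delta>. norm (x \<delta> - x 0))"
    using eventually_compose_filterlim[OF K(2) lim] by (intro bigoI[of _ K]) simp
  from landau_o.big_trans[OF this solution_bigo]
  have "(\<lambda>\<delta>. norm (emp_cov p (DF (x \<delta>)) (F (x \<delta>)) - \<beta>)) \<in> O[at 0](\<lambda>\<delta>. \<delta>)" .
  moreover have "(\<lambda>\<delta>. \<bar>\<delta> / \<kappa>\<bar>) \<in> O[at 0](\<lambda>\<delta>. \<delta>)"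
    using kappa_pos by (intro bigoI[of _ "1 / \<kappa>"]) simp
  ultimately have "(\<lambda>\<delta>. \<bar>\<delta> / \<kappa>\<bar> * norm (emp_cov p (DF (x \<delta>)) (F (x \<delta>)) - \<beta>)) \<in> O[at 0](\<lambda>\<delta>. \<delta> * \<delta>)"
    by (intro landau_o.big.mult)
  then show ?thesis by (simp add: power2_eq_square)
qed

lemma linearized_solution_smallo:
  "(\<lambda>\<delta>. norm (A *v (x \<delta> - x 0) - (\<delta> / \<kappa>) *\<^sub>R \<beta>)) \<in> o[at 0](\<lambda>\<delta>. \<delta>)"
proof -
  have "(\<lambda>\<delta>. norm (stationarity_defect \<delta> (x \<delta>))
      + norm ((\<delta> / \<kappa>) *\<^sub>R (emp_cov p (DF (x \<delta>)) (F (x \<delta>)) - \<beta>)) + norm (remainder \<delta>)) \<in> o[at 0](\<lambda>\<delta>. \<delta>)"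
    by (intro sum_in_smallo stationarity_defect_smallo[OF sol]
        landau_o.big_small_trans[OF covariance_term_bigo square_smallo_ident]
        landau_o.small_big_trans[OF gradient_remainder_smallo[OF lim] solution_bigo])
  moreover have "(\<lambda>\<delta>. norm (A *v (x \<delta> - x 0) - (\<delta> / \<kappa>) *\<^sub>R \<beta>)) \<in> O[at 0](\<lambda>\<delta>. norm (stationarity_defect \<delta> (x \<delta>))
      + norm ((\<delta> / \<kappa>) *\<^sub>R (emp_cov p (DF (x \<delta>)) (F (x \<delta>)) - \<beta>)) + norm (remainder \<delta>))"
    unfolding linearized_defect
    by (rule norm_add_diff_bigo)
  ultimately show ?thesis by (rule landau_o.big_small_trans[rotated])
qed

text \<open>The covariance drift is already quadratic, being \<delta> times a Lipschitz increment
  along a path of rate \<open>O(\<delta>)\<close>. The two Lipschitz assumptions upgrade the Taylor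
  remainder and the stationarity defect.\<close>

lemma linearized_solution_bigo:
  assumes "\<And>i. lipschitz_near (hessian (\<lambda>z. F z i)) (x 0)" "lipschitz_near (deriv2 \<phi>) 1"
  shows "(\<lambda>\<delta>. norm (A *v (x \<delta> - x 0) - (\<delta> / \<kappa>) *\<^sub>R \<beta>)) \<in> O[at 0](\<lambda>\<delta>. \<delta>\<^sup>2)"
proof -
  have "(\<lambda>\<delta>. norm (stationarity_defect \<delta> (x \<delta>))
      + norm ((\<delta> / \<kappa>) *\<^sub>R (emp_cov p (DF (x \<delta>)) (F (x \<delta>)) - \<beta>)) + norm (remainder \<delta>)) \<in> O[at 0](\<lambda>\<delta>. \<delta>\<^sup>2)"
    by (intro sum_in_bigo stationarity_defect_bigo[OF sol assms(2)] covariance_term_bigo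
        landau_o.big_trans[OF gradient_remainder_bigo[OF lim assms(1)] solution_square_bigo])
  moreover have "(\<lambda>\<delta>. norm (A *v (x \<delta> - x 0) - (\<delta> / \<kappa>) *\<^sub>R \<beta>)) \<in> O[at 0](\<lambda>\<delta>. norm (stationarity_defect \<delta> (x \<delta>))
      + norm ((\<delta> / \<kappa>) *\<^sub>R (emp_cov p (DF (x \<delta>)) (F (x \<delta>)) - \<beta>)) + norm (remainder \<delta>))"
    unfolding linearized_defect
    by (rule norm_add_diff_bigo)
  ultimately show ?thesis by (rule landau_o.big_trans[rotated])
qed

abbreviation sensitivity_remainder :: "real \<Rightarrow> real" where
  "sensitivity_remainder \<delta> \<equiv> sensitivity \<phi> p (F (x \<delta>)) -
     (sensitivity \<phi> p (F (x 0)) + 2 * \<delta> / \<kappa>\<^sup>2 * (\<beta> \<bullet> (matrix_inv A *v \<beta>)))"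

text \<open>An exact splitting: the curvature of the variance along the true displacement, plus the
  error of the linearized equation carried through the inverse Hessian.\<close>

lemma sensitivity_remainder_eq:
  "sensitivity_remainder \<delta> =
     (emp_var p (F (x \<delta>)) - emp_var p (F (x 0)) - 2 * (\<beta> \<bullet> (x \<delta> - x 0))) / \<kappa>
     + 2 / \<kappa> * (\<beta> \<bullet> (matrix_inv A *v (A *v (x \<delta> - x 0) - (\<delta> / \<kappa>) *\<^sub>R \<beta>)))"
proof -
  have "matrix_inv A *v (A *v (x \<delta> - x 0) - (\<delta> / \<kappa>) *\<^sub>R \<beta>) = (x \<delta> - x 0) - (\<delta> / \<kappa>) *\<^sub>R (matrix_inv A *v \<beta>)"
    by (simp only: matrix_vector_mult_diff_distrib matrix_vector_mult_scaleR inverse_hessian_cancel)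
  then show ?thesis
    using kappa_pos unfolding sensitivity_eq
    by (simp only: inner_diff_right inner_scaleR_right) (simp add: field_simps power2_eq_square)
qed

lemma sensitivity_remainder_bigo:
  "sensitivity_remainder \<in> O[at 0](\<lambda>\<delta>. (norm (x \<delta> - x 0))\<^sup>2 + norm (A *v (x \<delta> - x 0) - (\<delta> / \<kappa>) *\<^sub>R \<beta>))"
proof -
  obtain K where K: "0 \<le> K" and ev: "\<forall>\<^sub>F z in nhds (x 0).
      \<bar>emp_var p (F z) - emp_var p (F (x 0)) - 2 * (\<beta> \<bullet> (z - x 0))\<bar> \<le> K * norm (z - x 0)^2"
    using emp_var_expansion by blast
  define C where "C = max (K / \<kappa>) (2 / \<kappa> * (norm \<beta> * norm (matrix_inv A)))"
  from eventually_compose_filterlim[OF ev lim]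
  have "\<forall>\<^sub>F \<delta> in at 0. norm (sensitivity_remainder \<delta>)
      \<le> C * norm ((norm (x \<delta> - x 0))\<^sup>2 + norm (A *v (x \<delta> - x 0) - (\<delta> / \<kappa>) *\<^sub>R \<beta>))"
  proof eventually_elim
    case (elim \<delta>)
    define y where "y = A *v (x \<delta> - x 0) - (\<delta> / \<kappa>) *\<^sub>R \<beta>"
    define a where "a = emp_var p (F (x \<delta>)) - emp_var p (F (x 0)) - 2 * (\<beta> \<bullet> (x \<delta> - x 0))"
    have "\<bar>\<beta> \<bullet> (matrix_inv A *v y)\<bar> \<le> norm \<beta> * norm (matrix_inv A *v y)" by (rule Cauchy_Schwarz_ineq2)
    also have "\<dots> \<le> norm \<beta> * (norm (matrix_inv A) * norm y)"
      by (intro mult_left_mono norm_inverse_hessian_le) auto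
    finally have "2 / \<kappa> * \<bar>\<beta> \<bullet> (matrix_inv A *v y)\<bar> \<le> 2 / \<kappa> * (norm \<beta> * (norm (matrix_inv A) * norm y))"
      using kappa_pos by (intro mult_left_mono) auto
    also have "\<dots> = (2 / \<kappa> * (norm \<beta> * norm (matrix_inv A))) * norm y" by simp
    also have "\<dots> \<le> C * norm y" by (intro mult_right_mono) (auto simp: C_def)
    finally have 1: "2 / \<kappa> * \<bar>\<beta> \<bullet> (matrix_inv A *v y)\<bar> \<le> C * norm y" .
    have "\<bar>a\<bar> / \<kappa> \<le> K / \<kappa> * (norm (x \<delta> - x 0))\<^sup>2"
      using divide_right_mono[OF elim less_imp_le[OF kappa_pos]] by (simp add: a_def)
    also have "\<dots> \<le> C * (norm (x \<delta> - x 0))\<^sup>2" by (intro mult_right_mono) (auto simp: C_def)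
    finally have 2: "\<bar>a\<bar> / \<kappa> \<le> C * (norm (x \<delta> - x 0))\<^sup>2" .
    have "\<bar>a / \<kappa> + 2 / \<kappa> * (\<beta> \<bullet> (matrix_inv A *v y))\<bar> \<le> \<bar>a\<bar> / \<kappa> + 2 / \<kappa> * \<bar>\<beta> \<bullet> (matrix_inv A *v y)\<bar>"
      using abs_triangle_ineq[of "a / \<kappa>" "2 / \<kappa> * (\<beta> \<bullet> (matrix_inv A *v y))"] kappa_pos
      by (simp only: abs_mult abs_divide abs_numeral abs_of_pos)
    also have "\<dots> \<le> C * ((norm (x \<delta> - x 0))\<^sup>2 + norm y)" using 1 2 by (simp only: distrib_left)
    finally show ?case unfolding sensitivity_remainder_eq a_def y_def by simp
  qed
  then show ?thesis by (rule bigoI)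
qed

theorem sensitivity_expansion_smallo: "sensitivity_remainder \<in> o[at 0](\<lambda>\<delta>. \<delta>)"
  by (rule landau_o.big_small_trans[OF sensitivity_remainder_bigo], rule sum_in_smallo)
     (rule landau_o.big_small_trans[OF solution_square_bigo square_smallo_ident], rule linearized_solution_smallo)

theorem sensitivity_expansion_bigo:
  assumes "\<And>i. lipschitz_near (hessian (\<lambda>z. F z i)) (x 0)" "lipschitz_near (deriv2 \<phi>) 1"
  shows "sensitivity_remainder \<in> O[at 0](\<lambda>\<delta>. \<delta>\<^sup>2)"
  by (rule landau_o.big_trans[OF sensitivity_remainder_bigo], rule sum_in_bigo)
     (rule solution_square_bigo, rule linearized_solution_bigo[OF assms])

lemma inverse_hessian_covariance_negative:
  "\<beta> \<noteq> 0 \<Longrightarrow> \<beta> \<bullet> (matrix_inv A *v \<beta>) < 0"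
  by (rule inverse_hessian_negative[OF maximizer inv])

end

end

text \<open>The remainder is charged with tolerance \<open>- c / 2\<close>, so half of the slope is
  left and the sign of \<delta> decides.\<close>

lemma eventually_decreasing_at_zero:
  fixes S :: "real \<Rightarrow> real"
  assumes "(\<lambda>\<delta>. S \<delta> - (S 0 + \<delta> * c)) \<in> o[at 0](\<lambda>\<delta>. \<delta>)" and "c < 0"
  shows "\<forall>\<^sub>F \<delta> in at_left 0. S 0 < S \<delta>" "\<forall>\<^sub>F \<delta> in at_right 0. S \<delta> < S 0"
proof -
  have "\<forall>\<^sub>F \<delta> in at 0. norm (S \<delta> - (S 0 + \<delta> * c)) \<le> (- c / 2) * norm \<delta>"
    by (rule landau_o.smallD[OF assms(1)]) (use assms(2) in simp)
  then have ev: "\<forall>\<^sub>F \<delta> in at_left 0. norm (S \<delta> - (S 0 + \<delta> * c)) \<le> (- c / 2) * norm \<delta>"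
    "\<forall>\<^sub>F \<delta> in at_right 0. norm (S \<delta> - (S 0 + \<delta> * c)) \<le> (- c / 2) * norm \<delta>"
    unfolding eventually_at_split by auto
  have "\<forall>\<^sub>F \<delta> in at_left 0. \<delta> < (0::real)" by (simp add: eventually_at_filter)
  with ev(1) show "\<forall>\<^sub>F \<delta> in at_left 0. S 0 < S \<delta>"
  proof eventually_elim
    case (elim \<delta>)
    then have "0 < \<delta> * c" using assms(2) by (simp add: mult_neg_neg)
    moreover have "\<bar>S \<delta> - (S 0 + \<delta> * c)\<bar> \<le> \<delta> * c / 2" using elim by (simp add: mult.commute)
    ultimately show ?case by linarith
  qed
  have "\<forall>\<^sub>F \<delta> in at_right 0. (0::real) < \<delta>" by (simp add: eventually_at_filter)
  with ev(2) show "\<forall>\<^sub>F \<delta> in at_right 0. S \<delta> < S 0"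
  proof eventually_elim
    case (elim \<delta>)
    then have "\<delta> * c < 0" using assms(2) by (simp add: mult_pos_neg)
    moreover have "\<bar>S \<delta> - (S 0 + \<delta> * c)\<bar> \<le> - (\<delta> * c) / 2" using elim by (simp add: mult.commute)
    ultimately show ?case by linarith
  qed
qed

text \<open>The null set is fixed before \<open>x\<close>, so the solution path may depend on
  \<omega> arbitrarily; outside it every sampled reward is strictly concave and twice continuously
  differentiable. The remainder comes in two strengths, matching the two levels of regularity.
  Strict comparisons are claimed for \<open>\<beta> \<noteq> 0\<close>, since the linear coefficient
  vanishes otherwise.\<close>

theorem mainTheorem2:
  fixes M :: "'w measure"
    and Y :: "'n::finite \<Rightarrow> 'w \<Rightarrow> real^'l"
    and P :: "(real^'l) measure"
    and p :: "real^'n"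
    and f :: "real^'d \<Rightarrow> real^'l \<Rightarrow> real"
    and \<phi> :: "real \<Rightarrow> ereal"
  assumes "prob_space M"
    and "prob_space.indep_vars M (\<lambda>_. borel) Y UNIV"
    and "\<And>i. distr M borel (Y i) = P"
    and "p \<in> prob_vectors" and "\<And>i. 0 < p $ i"
    and "basic_assumptions P f"
    and "divergence_function \<phi>"
  shows "AE \<omega> in M. \<forall>x :: real \<Rightarrow> real^'d.
    (\<forall>\<^sub>F \<delta> in nhds 0. solves \<phi> p (\<lambda>z i. f z (Y i \<omega>)) \<delta> (x \<delta>)) \<longrightarrow>
    (let S = (\<lambda>\<delta>. sensitivity \<phi> p (\<lambda>i. f (x \<delta>) (Y i \<omega>)));
         \<beta> = emp_cov p (\<lambda>i. grad (\<lambda>z. f z (Y i \<omega>)) (x 0)) (\<lambda>i. f (x 0) (Y i \<omega>));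
         A = emp_mean p (\<lambda>i. hessian (\<lambda>z. f z (Y i \<omega>)) (x 0));
         R = (\<lambda>\<delta>. S \<delta> - (S 0 + 2 * \<delta> / (deriv2 \<phi> 1)\<^sup>2 * (\<beta> \<bullet> (matrix_inv A *v \<beta>))))
     in invertible A \<longrightarrow>
          R \<in> o[at 0](\<lambda>\<delta>. \<delta>) \<and>
          ((\<forall>i. lipschitz_near (hessian (\<lambda>z. f z (Y i \<omega>))) (x 0)) \<and> lipschitz_near (deriv2 \<phi>) 1
             \<longrightarrow> R \<in> O[at 0](\<lambda>\<delta>. \<delta>\<^sup>2)) \<and>
          (\<beta> \<noteq> 0 \<longrightarrow>
             \<beta> \<bullet> (matrix_inv A *v \<beta>) < 0 \<and>
             (\<forall>\<^sub>F \<delta> in at_left 0. S 0 < S \<delta>) \<and>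
             (\<forall>\<^sub>F \<delta> in at_right 0. S \<delta> < S 0)))"
proof -
  interpret prob_space M by fact
  have Y: "Y i \<in> borel_measurable M" for i
    using assms(2) by (auto simp: indep_vars_def)
  have "AE y in P. strictly_concave (\<lambda>x. f x y) \<and> twice_cont_diff (\<lambda>x. f x y)"
    using assms(6) by (simp add: basic_assumptions_def)
  then have "AE \<omega> in M. strictly_concave (\<lambda>x. f x (Y i \<omega>)) \<and> twice_cont_diff (\<lambda>x. f x (Y i \<omega>))" for i
    by (intro AE_distrD[OF Y[of i]]) (simp only: assms(3))
  then have "AE \<omega> in M. \<forall>i. strictly_concave (\<lambda>x. f x (Y i \<omega>)) \<and> twice_cont_diff (\<lambda>x. f x (Y i \<omega>))"
    by (subst AE_all_countable) blast
  then show ?thesis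
  proof eventually_elim
    case (elim \<omega>)
    obtain e where "smooth_divergence \<phi> p e"
      using smooth_divergence_exists[OF assms(7,4,5)] .
    then interpret smooth_divergence \<phi> p e .
    interpret scenario_problem \<phi> p e "\<lambda>z i. f z (Y i \<omega>)"
      using elim by unfold_locales auto
    show ?case
    proof (intro allI impI, unfold Let_def, intro impI, goal_cases)
      case (1 x)
      note sol = 1(1) and inv = 1(2)
      define S where "S = (\<lambda>\<delta>. sensitivity \<phi> p (\<lambda>i. f (x \<delta>) (Y i \<omega>)))"
      define b where "b = emp_cov p (\<lambda>i. grad (\<lambda>z. f z (Y i \<omega>)) (x 0)) (\<lambda>i. f (x 0) (Y i \<omega>))"
      define c where "c = b \<bullet> (matrix_inv (emp_mean p (\<lambda>i. hessian (\<lambda>z. f z (Y i \<omega>)) (x 0))) *v b)"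
      have small: "(\<lambda>\<delta>. S \<delta> - (S 0 + 2 * \<delta> / (deriv2 \<phi> 1)\<^sup>2 * c)) \<in> o[at 0](\<lambda>\<delta>. \<delta>)"
        unfolding S_def c_def b_def by (rule sensitivity_expansion_smallo[OF sol inv])
      have big: "(\<lambda>\<delta>. S \<delta> - (S 0 + 2 * \<delta> / (deriv2 \<phi> 1)\<^sup>2 * c)) \<in> O[at 0](\<lambda>\<delta>. \<delta>\<^sup>2)"
        if "\<forall>i. lipschitz_near (hessian (\<lambda>z. f z (Y i \<omega>))) (x 0)" "lipschitz_near (deriv2 \<phi>) 1"
        unfolding S_def c_def b_def
        by (rule sensitivity_expansion_bigo[OF sol inv]) (use that in auto)
      have neg: "c < 0" if "b \<noteq> 0"
        unfolding c_def b_def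
        by (rule inverse_hessian_covariance_negative[OF sol inv that[unfolded b_def]])
      have "(\<lambda>\<delta>. S \<delta> - (S 0 + \<delta> * (2 / (deriv2 \<phi> 1)\<^sup>2 * c))) \<in> o[at 0](\<lambda>\<delta>. \<delta>)"
        using small by (simp add: mult_ac)
      note mono = eventually_decreasing_at_zero[OF this]
      have coeff: "2 / (deriv2 \<phi> 1)\<^sup>2 * c < 0" if "b \<noteq> 0"
        using neg[OF that] kappa_pos by (intro mult_pos_neg) auto
      show ?case
        using small big neg mono[OF coeff] unfolding S_def b_def[symmetric] c_def[symmetric] by blast
    qed
  qed
qed

end
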